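(* Let $L\ge1$ and let $b:\Omega\to\mathbf{R}$ satisfy $\sup_\Omega|b|<\frac1{2d}$ and $b(2L+1-n,y)=-b(n,y)$ for $1\le n\le2L$, $y\in\Omega_{d-1}$. Let $\varphi^*$ be the invariant measure, normalized by $\langle\varphi^*\rangle_{\hat\Omega}=1$, for random walk on $\hat\Omega$ with drift $b$ in the $\mathbf{e}_1$ direction and reflecting boundary conditions, and set $$\psi(y)=\Big[\frac1{2d}-b(1,y)\Big]\varphi^*(1,y),\qquad y\in\Omega_{d-1}.$$ Let $\psi_R$ be defined exactly as $\psi$ but with $b$ replaced by $-b$ (both in the prefactor and in the definition of the invariant measure). Then the effective diffusion constant $q(b)$ is given by $$q(b)=8d\,\Big\langle\psi\,[-\Delta_{d-1}+4]^{-1}\psi_R\Big\rangle_{\Omega_{d-1}} .$$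
   Context: $d\ge1$, $L_2,\dots,L_d$ are positive integers, $L_1=2L$. $\Omega_{d-1}$ is the set of integer points of the $(d-1)$-dimensional torus $\prod_{i=2}^d[0,L_i]$ with periodic boundary conditions (a single point if $d=1$). $\Omega=\{(n,y):1\le n\le2L,\ y\in\Omega_{d-1}\}$ with periodic boundary conditions (period $2L$ in $n$), and $\hat\Omega=\{(n,y):1\le n\le L,\ y\in\Omega_{d-1}\}$. $\langle\cdot\rangle_{\hat\Omega}$ and $\langle\cdot\rangle_{\Omega_{d-1}}$ denote averages over the uniform probability measures. $\Delta_{d-1}$ is the finite difference Laplacian $\Delta_{d-1}\Psi(y)=\sum_{j=2}^d[\Psi(y+\mathbf{e}_j)+\Psi(y-\mathbf{e}_j)-2\Psi(y)]$ on functions on $\Omega_{d-1}$. The random walk on $\hat\Omega$ is the continuous time Markov chain which jumps from $(n,y)$ to $(n,y\pm\mathbf{e}_j)$, $2\le j\le d$, at rate $\frac1{2d}$ each, to $(n+1,y)$ at rate $\frac1{2d}+b(n,y)$ and to $(n-1,y)$ at rate $\frac1{2d}-b(n,y)$, jumps leaving $\hat\Omega$ being suppressed (reflecting boundary conditions). Its invariant measure is regarded as a density $\varphi^*>0$ with respect to the uniform measure on $\hat\Omega$. Effective diffusion constant: $\tau_x$ denotes translation by $x\in\mathbf{Z}^d$ on $\Omega$. $q(b)\in(0,\infty)$ is the number (it exists) such that for every smooth compactly supported $f:\mathbf{R}^d\to\mathbf{R}$: if for $\varepsilon>0$, $u_\varepsilon(x,\omega)$ ($x\in\varepsilon\mathbf{Z}^d$,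 $\omega\in\Omega$) is the unique bounded solution of $$u_\varepsilon(x,\omega)-\sum_{i=1}^d\frac{1}{2d}[u_\varepsilon(x+\varepsilon\mathbf{e}_i,\omega)+u_\varepsilon(x-\varepsilon\mathbf{e}_i,\omega)]-b(\tau_{x/\varepsilon}\omega)[u_\varepsilon(x+\varepsilon\mathbf{e}_1,\omega)-u_\varepsilon(x-\varepsilon\mathbf{e}_1,\omega)]+\varepsilon^2u_\varepsilon(x,\omega)=\varepsilon^2f(x),$$ and $u$ is the bounded solution of $-q(b)\,\partial^2u/\partial x_1^2-\sum_{j=2}^d\frac1{2d}\,\partial^2u/\partial x_j^2+u=f$ on $\mathbf{R}^d$, then $\lim_{\varepsilon\to0}\sup_{x\in\mathbf{R}^d,\omega\in\Omega}|u_\varepsilon(\varepsilon\lfloor x/\varepsilon\rfloor,\omega)-u(x)|=0$. *)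

theory Defs
  imports "HOL-Analysis.Analysis"
begin

text \<open>
  The coordinate directions of \<open>\<real>\<^sup>d\<close> and \<open>\<int>\<^sup>d\<close> are the elements of a finite type \<open>'n\<close>, so
  \<open>d = CARD('n)\<close>, and \<open>i1 :: 'n\<close> is the direction of the drift (direction 1 of the mathematics;
  the directions \<open>2, \<dots>, d\<close> are the \<open>j \<noteq> i1\<close>; there are none if \<open>d = 1\<close>).  The half period in
  direction \<open>i1\<close> is \<open>L\<close>, and \<open>ell j\<close> is the period in direction \<open>j \<noteq> i1\<close>; the value \<open>ell i1\<close> is not used.
\<close>

definition avg :: "'a set \<Rightarrow> ('a \<Rightarrow> real) \<Rightarrow> real" where
  "avg A g = (\<Sum>a\<in>A. g a) / real (card A)"


section \<open>The discrete tori\<close>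

text \<open>
  A point \<open>y\<close> of the \<open>(d-1)\<close>-dimensional torus is given by its representative in \<open>\<int>\<^sup>d\<close> with
  \<open>0 \<le> y $ j < ell j\<close> and with the irrelevant coordinate \<open>y $ i1\<close> set to 0.
\<close>

definition torus :: "'n::finite \<Rightarrow> ('n \<Rightarrow> nat) \<Rightarrow> (int ^ 'n) set" where
  "torus i1 ell = {y. y $ i1 = 0 \<and> (\<forall>j. j \<noteq> i1 \<longrightarrow> 0 \<le> y $ j \<and> y $ j < int (ell j))}"

definition torus_add :: "'n::finite \<Rightarrow> ('n \<Rightarrow> nat) \<Rightarrow> int ^ 'n \<Rightarrow> int ^ 'n \<Rightarrow> int ^ 'n" where
  "torus_add i1 ell y x = (\<chi> j. if j = i1 then 0 else (y $ j + x $ j) mod int (ell j))"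

definition Omega :: "'n::finite \<Rightarrow> nat \<Rightarrow> ('n \<Rightarrow> nat) \<Rightarrow> (int \<times> (int ^ 'n)) set" where
  "Omega i1 L ell = {1..2 * int L} \<times> torus i1 ell"

definition Omega_hat :: "'n::finite \<Rightarrow> nat \<Rightarrow> ('n \<Rightarrow> nat) \<Rightarrow> (int \<times> (int ^ 'n)) set" where
  "Omega_hat i1 L ell = {1..int L} \<times> torus i1 ell"

definition translate ::
  "'n::finite \<Rightarrow> nat \<Rightarrow> ('n \<Rightarrow> nat) \<Rightarrow> int ^ 'n \<Rightarrow> int \<times> (int ^ 'n) \<Rightarrow> int \<times> (int ^ 'n)" where
  "translate i1 L ell x = (\<lambda>(n, y). (1 + (n + x $ i1 - 1) mod (2 * int L), torus_add i1 ell y x))"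


section \<open>The resolvent of the finite difference Laplacian\<close>

definition laplacian ::
  "'n::finite \<Rightarrow> ('n \<Rightarrow> nat) \<Rightarrow> (int ^ 'n \<Rightarrow> real) \<Rightarrow> int ^ 'n \<Rightarrow> real" where
  "laplacian i1 ell g y =
     (\<Sum>j\<in>UNIV - {i1}. g (torus_add i1 ell y (axis j 1)) + g (torus_add i1 ell y (- axis j 1)) - 2 * g y)"

text \<open>
  \<open>-\<Delta> + 4\<close> as an operator on the functions on the torus, and its inverse; a function on the torus
  is represented by its extensional extension (library set \<open>extensional\<close>).
\<close>

definition neg_laplacian_plus_4 ::
  "'n::finite \<Rightarrow> ('n \<Rightarrow> nat) \<Rightarrow> (int ^ 'n \<Rightarrow> real) \<Rightarrow> int ^ 'n \<Rightarrow> real" where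
  "neg_laplacian_plus_4 i1 ell g = (\<lambda>y\<in>torus i1 ell. - laplacian i1 ell g y + 4 * g y)"

definition inv_neg_laplacian_plus_4 ::
  "'n::finite \<Rightarrow> ('n \<Rightarrow> nat) \<Rightarrow> (int ^ 'n \<Rightarrow> real) \<Rightarrow> int ^ 'n \<Rightarrow> real" where
  "inv_neg_laplacian_plus_4 i1 ell g =
     the_inv_into (extensional (torus i1 ell)) (neg_laplacian_plus_4 i1 ell) (restrict g (torus i1 ell))"


section \<open>The reflected random walk and its invariant measure\<close>

text \<open>
  Jump rate from \<open>(n, y)\<close> to \<open>\<omega>'\<close>.  Rates of different jumps with the same target are added (this
  occurs for \<open>ell j = 2\<close>), and for \<open>ell j = 1\<close> there are jumps from a point to itself, which have no
  effect.  The targets \<open>(n \<plusminus> 1, y)\<close> are not taken modulo \<open>2 * L\<close>: those outside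
  \<open>Omega_hat\<close> are dropped in \<open>invariant_density\<close>, which sums over \<open>Omega_hat\<close> only.
\<close>

definition jump_rate ::
  "'n::finite \<Rightarrow> ('n \<Rightarrow> nat) \<Rightarrow> (int \<times> (int ^ 'n) \<Rightarrow> real)
     \<Rightarrow> int \<times> (int ^ 'n) \<Rightarrow> int \<times> (int ^ 'n) \<Rightarrow> real" where
  "jump_rate i1 ell b = (\<lambda>(n, y) \<omega>'.
     (\<Sum>j\<in>UNIV - {i1}.
        1 / (2 * real CARD('n)) * of_bool (\<omega>' = (n, torus_add i1 ell y (axis j 1)))
      + 1 / (2 * real CARD('n)) * of_bool (\<omega>' = (n, torus_add i1 ell y (- axis j 1))))
     + (1 / (2 * real CARD('n)) + b (n, y)) * of_bool (\<omega>' = (n + 1, y))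
     + (1 / (2 * real CARD('n)) - b (n, y)) * of_bool (\<omega>' = (n - 1, y)))"

text \<open>
  Invariance \<open>\<mu> Q = 0\<close> for the generator \<open>Q\<close> of the chain, i.e. the stationary master equation
  (rate of inflow = rate of outflow at each state).  As the reference measure is uniform, it can be
  written with the density \<open>\<phi>\<close> in place of the measure.
\<close>

definition invariant_density ::
  "'n::finite \<Rightarrow> nat \<Rightarrow> ('n \<Rightarrow> nat) \<Rightarrow> (int \<times> (int ^ 'n) \<Rightarrow> real)
     \<Rightarrow> (int \<times> (int ^ 'n) \<Rightarrow> real) \<Rightarrow> bool" where
  "invariant_density i1 L ell b \<phi> \<longleftrightarrow>
     (\<forall>\<omega>\<in>Omega_hat i1 L ell. \<phi> \<omega> > 0) \<and>
     (\<forall>\<omega>'\<in>Omega_hat i1 L ell.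
        (\<Sum>\<omega>\<in>Omega_hat i1 L ell. \<phi> \<omega> * jump_rate i1 ell b \<omega> \<omega>')
        = \<phi> \<omega>' * (\<Sum>\<omega>\<in>Omega_hat i1 L ell. jump_rate i1 ell b \<omega>' \<omega>)) \<and>
     avg (Omega_hat i1 L ell) \<phi> = 1"

definition psi ::
  "(int \<times> (int ^ 'n::finite) \<Rightarrow> real) \<Rightarrow> (int \<times> (int ^ 'n) \<Rightarrow> real) \<Rightarrow> int ^ 'n \<Rightarrow> real" where
  "psi b \<phi> y = (1 / (2 * real CARD('n)) - b (1, y)) * \<phi> (1, y)"


section \<open>The effective diffusion constant\<close>

definition partial :: "'n::finite \<Rightarrow> (real ^ 'n \<Rightarrow> real) \<Rightarrow> real ^ 'n \<Rightarrow> real" where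
  "partial i f x = frechet_derivative f (at x) (axis i 1)"

primrec cont_diff :: "nat \<Rightarrow> (real ^ 'n::finite \<Rightarrow> real) \<Rightarrow> bool" where
  "cont_diff 0 f \<longleftrightarrow> continuous_on UNIV f"
| "cont_diff (Suc k) f \<longleftrightarrow> (\<forall>x. f differentiable (at x)) \<and> (\<forall>i. cont_diff k (partial i f))"

definition smooth :: "(real ^ 'n::finite \<Rightarrow> real) \<Rightarrow> bool" where
  "smooth f \<longleftrightarrow> (\<forall>k. cont_diff k f)"

definition compactly_supported :: "(real ^ 'n::finite \<Rightarrow> real) \<Rightarrow> bool" where
  "compactly_supported f \<longleftrightarrow> compact (closure {x. f x \<noteq> 0})"

text \<open>The point \<open>\<epsilon> k\<close> of the lattice \<open>\<epsilon> \<int>\<^sup>d\<close>.\<close>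

definition lattice_point :: "real \<Rightarrow> int ^ 'n::finite \<Rightarrow> real ^ 'n" where
  "lattice_point \<epsilon> k = (\<chi> i. \<epsilon> * real_of_int (k $ i))"

definition bounded_lattice_solution ::
  "'n::finite \<Rightarrow> nat \<Rightarrow> ('n \<Rightarrow> nat) \<Rightarrow> (int \<times> (int ^ 'n) \<Rightarrow> real) \<Rightarrow> (real ^ 'n \<Rightarrow> real)
     \<Rightarrow> real \<Rightarrow> (real ^ 'n \<Rightarrow> int \<times> (int ^ 'n) \<Rightarrow> real) \<Rightarrow> bool" where
  "bounded_lattice_solution i1 L ell b f \<epsilon> u \<longleftrightarrow>
     (\<exists>C. \<forall>k. \<forall>\<omega>\<in>Omega i1 L ell. \<bar>u (lattice_point \<epsilon> k) \<omega>\<bar> \<le> C) \<and>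
     (\<forall>k. \<forall>\<omega>\<in>Omega i1 L ell. let x = lattice_point \<epsilon> k in
        u x \<omega>
        - (\<Sum>i\<in>UNIV. 1 / (2 * real CARD('n)) *
             (u (x + \<epsilon> *\<^sub>R axis i 1) \<omega> + u (x - \<epsilon> *\<^sub>R axis i 1) \<omega>))
        - b (translate i1 L ell k \<omega>) *
             (u (x + \<epsilon> *\<^sub>R axis i1 1) \<omega> - u (x - \<epsilon> *\<^sub>R axis i1 1) \<omega>)
        + \<epsilon>\<^sup>2 * u x \<omega>
        = \<epsilon>\<^sup>2 * f x)"

definition bounded_homogenized_solution ::
  "'n::finite \<Rightarrow> real \<Rightarrow> (real ^ 'n \<Rightarrow> real) \<Rightarrow> (real ^ 'n \<Rightarrow> real) \<Rightarrow> bool" where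
  "bounded_homogenized_solution i1 q f u \<longleftrightarrow>
     bounded (range u) \<and> cont_diff 2 u \<and>
     (\<forall>x. - q * partial i1 (partial i1 u) x
          - (\<Sum>j\<in>UNIV - {i1}. 1 / (2 * real CARD('n)) * partial j (partial j u) x)
          + u x = f x)"

definition effective_diffusion_constant ::
  "'n::finite \<Rightarrow> nat \<Rightarrow> ('n \<Rightarrow> nat) \<Rightarrow> (int \<times> (int ^ 'n) \<Rightarrow> real) \<Rightarrow> real \<Rightarrow> bool" where
  "effective_diffusion_constant i1 L ell b q \<longleftrightarrow>
     q > 0 \<and>
     (\<forall>f u\<^sub>\<epsilon> u.
        smooth f \<and> compactly_supported f \<and>
        (\<forall>\<epsilon>>0. bounded_lattice_solution i1 L ell b f \<epsilon> (u\<^sub>\<epsilon> \<epsilon>)) \<and>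
        bounded_homogenized_solution i1 q f u \<longrightarrow>
        ((\<lambda>\<epsilon>. SUP (x, \<omega>)\<in>UNIV \<times> Omega i1 L ell.
             \<bar>u\<^sub>\<epsilon> \<epsilon> (lattice_point \<epsilon> (\<chi> i. \<lfloor>x $ i / \<epsilon>\<rfloor>)) \<omega> - u x\<bar>) \<longlongrightarrow> 0) (at_right 0))"

end

(*
  Extended by reflection to all n, the density phi_R of the walk with drift -b is the difference
  (X(n+1) - X(n-1)) / 2 of the harmonic coordinate X of the walk with drift b: differencing the harmonicity
  equation of X gives the stationary equation for -b.  So phi_R determines X, with
  X(1,.) = 4d (-Laplacian + 4)^{-1} psi_R by oddness under the reflection in 1/2.  Green's identity with phi
  and X, X^2 on the half period evaluates the average of the generator applied to X^2 as 4 <psi X(1,.)>,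
  which is twice the claimed value q*.

  To identify q with q*, use a bump function u and the right-hand side f for which u solves the
  homogenized equation with q.  By the Fredholm alternative X^2 has a bounded corrector that makes the generator
  constant, so lattice paraboloids with exact generator 2 q* in direction 1 touch u_epsilon from below near
  the origin (perturbed test functions).  Comparing the equations at the touching point for u and for -u
  gives q = q*.
*)

theory Submission
  imports Defs
begin

section \<open>Finite linear systems, Markov kernels and contractions\<close>

text \<open>The hypothesis on q is a convergence statement about given families u_eps, so it yields
  something only once lattice solutions have been produced; this is done by a contraction argument.
  Choosing the homogenized solution u first and reading f off its equation avoids solving a PDE.
  Uniform convergence gives no control of differences of u_eps, which is why the equations are
  compared at a touching point, where a minimum principle suffices. X itself is neither periodic nor
  even, but the generator applied to X^2 is both: X gains 2L per period and is odd, and the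
  generator kills X. Hence the corrector can be found on the half period, where the invariant
  density phi of the reflected walk is the solvability functional, and then unfolded. The corrected
  square differs from k_1^2 by O(|k_1|), which after scaling by eps^2 is O(eps) on a fixed ball. The
  bump has the same second derivative at 0 in every direction, so one isotropic paraboloid serves.
  The comparison then involves only the sum of the d diffusion coefficients, in which the transverse
  part is the same on both sides and cancels.\<close>

text \<open>Gaussian elimination. Rows and columns have separate index sets because one step removes
  the pivot row \<open>p\<close> and the column \<open>j\<close>, which need not correspond;
  \<open>M'\<close> is the matrix that remains.\<close>

lemma finite_system_solvable:
  fixes M :: "'r \<Rightarrow> 'c \<Rightarrow> real"
  assumes "finite J" "finite I" "card I = card J"
    and "\<And>g. (\<And>x. x \<in> I \<Longrightarrow> (\<Sum>y\<in>J. M x y * g y) = 0) \<Longrightarrow> \<forall>y\<in>J. g y = 0"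
  shows "\<exists>g. \<forall>x\<in>I. (\<Sum>y\<in>J. M x y * g y) = r x"
  using assms
proof (induction J arbitrary: I M r rule: finite_induct)
  case empty
  then show ?case by simp
next
  case (insert j J)
  \<comment> \<open>If column \<open>j\<close> vanished, the unit vector at \<open>j\<close> would
    be a nonzero kernel element.\<close>
  have "\<exists>p\<in>I. M p j \<noteq> 0"
  proof (rule ccontr)
    assume "\<not> ?thesis"
    then have "(\<Sum>y\<in>insert j J. M x y * of_bool (y = j)) = 0" if "x \<in> I" for x
      using that by (intro sum.neutral) auto
    from insert.prems(3)[OF this] show False by simp
  qed
  then obtain p where p: "p \<in> I" "M p j \<noteq> 0" by blast
  define M' where "M' x y = M x y - M x j * M p y / M p j" for x y
  have M'_sum: "(\<Sum>y\<in>J. M' x y * g y) =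
      (\<Sum>y\<in>J. M x y * g y) - M x j / M p j * (\<Sum>y\<in>J. M p y * g y)" for x g
    by (simp add: M'_def algebra_simps sum_subtractf sum_distrib_left)
  have split: "(\<Sum>y\<in>insert j J. M x y * (g(j := c)) y) = M x j * c + (\<Sum>y\<in>J. M x y * g y)" for x g c
    using insert.hyps by (auto intro!: sum.cong)
  have "\<exists>g. \<forall>x\<in>I - {p}. (\<Sum>y\<in>J. M' x y * g y) = r x - M x j * r p / M p j"
  proof (rule insert.IH)
    show "finite (I - {p})" "card (I - {p}) = card J"
      using insert.prems insert.hyps p by auto
  next
    fix g assume g: "\<And>x. x \<in> I - {p} \<Longrightarrow> (\<Sum>y\<in>J. M' x y * g y) = 0"
    define c where "c = - (\<Sum>y\<in>J. M p y * g y) / M p j"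
    have "(\<Sum>y\<in>insert j J. M x y * (g(j := c)) y) = 0" if "x \<in> I" for x
    proof (cases "x = p")
      case False
      with that g[of x] show ?thesis
        unfolding split M'_sum by (simp add: c_def field_simps)
    qed (use p in \<open>simp add: split c_def del: fun_upd_apply\<close>)
    from insert.prems(3)[OF this] insert.hyps show "\<forall>y\<in>J. g y = 0"
      by (metis fun_upd_other insertCI)
  qed
  then obtain g where g: "\<And>x. x \<in> I - {p} \<Longrightarrow> (\<Sum>y\<in>J. M' x y * g y) = r x - M x j * r p / M p j"
    by blast
  define c where "c = (r p - (\<Sum>y\<in>J. M p y * g y)) / M p j"
  have "(\<Sum>y\<in>insert j J. M x y * (g(j := c)) y) = r x" if "x \<in> I" for x
  proof (cases "x = p")
    case False
    with that g[of x] p show ?thesis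
      unfolding split M'_sum by (simp add: c_def field_simps)
  qed (use p in \<open>simp add: split c_def del: fun_upd_apply\<close>)
  then show ?case by blast
qed

text \<open>Irreducibility is expressed by the absence of proper nonempty closed sets, the form in
  which the maximum principle consumes it.\<close>

locale connected_kernel =
  fixes S :: "'a set" and J :: "'a \<Rightarrow> 'a \<Rightarrow> real"
  assumes S: "finite S" "S \<noteq> {}"
    and nonneg: "\<And>x y. x \<in> S \<Longrightarrow> y \<in> S \<Longrightarrow> J x y \<ge> 0"
    and connected: "\<And>Z. Z \<subseteq> S \<Longrightarrow> Z \<noteq> {} \<Longrightarrow>
          (\<And>x y. x \<in> Z \<Longrightarrow> y \<in> S \<Longrightarrow> J x y > 0 \<Longrightarrow> y \<in> Z) \<Longrightarrow> Z = S"
begin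

text \<open>Strong maximum principle: at a maximum all summands have the same sign, so each
  vanishes, and the set of maximum points is closed under jumps.\<close>

lemma harmonic_constant:
  assumes harmonic: "\<And>x. x \<in> S \<Longrightarrow> (\<Sum>y\<in>S. J x y * (g y - g x)) = 0"
  obtains c where "\<And>x. x \<in> S \<Longrightarrow> g x = c"
proof -
  define m where "m = Max (g ` S)"
  have le: "g x \<le> m" if "x \<in> S" for x
    using that S by (simp add: m_def)
  have "m \<in> g ` S" unfolding m_def using S by (intro Max_in) auto
  then have ne: "{x\<in>S. g x = m} \<noteq> {}" by auto
  have "{x\<in>S. g x = m} = S"
  proof (rule connected)
    fix x y assume x: "x \<in> {x\<in>S. g x = m}" and y: "y \<in> S" "J x y > 0"
    have "\<forall>y\<in>S. J x y * (g x - g y) = 0"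
    proof (subst sum_nonneg_eq_0_iff[symmetric])
      show "(\<Sum>y\<in>S. J x y * (g x - g y)) = 0"
        using harmonic[of x] x by (simp add: algebra_simps sum_subtractf)
    qed (use x nonneg le S in auto)
    with y x show "y \<in> {x\<in>S. g x = m}" by auto
  qed (use ne in auto)
  then show ?thesis using that[of m] by blast
qed

text \<open>The generator has the constants as kernel. Subtracting the rank-one operator that sends
  \<open>g\<close> to the constant function with value \<open>\<Sum>y\<in>S. \<phi> y * g y\<close>
  makes it injective, hence solvable. Pairing the solved equation with \<open>\<phi>\<close> shows
  that this constant is 0, so the extra term disappears again.\<close>

lemma fredholm:
  assumes pos: "\<And>x. x \<in> S \<Longrightarrow> \<phi> x > 0"
    and invariant: "\<And>g. (\<Sum>x\<in>S. \<phi> x * (\<Sum>y\<in>S. J x y * (g y - g x))) = 0"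
    and mean_zero: "(\<Sum>x\<in>S. \<phi> x * r x) = 0"
  obtains g where "\<And>x. x \<in> S \<Longrightarrow> (\<Sum>y\<in>S. J x y * (g y - g x)) = r x"
proof -
  define M where "M x y = J x y - of_bool (y = x) * (\<Sum>z\<in>S. J x z) - \<phi> y" for x y
  have M: "(\<Sum>y\<in>S. M x y * g y) = (\<Sum>y\<in>S. J x y * (g y - g x)) - (\<Sum>y\<in>S. \<phi> y * g y)"
    if "x \<in> S" for x g
  proof -
    have "(\<Sum>y\<in>S. M x y * g y) = (\<Sum>y\<in>S. J x y * g y)
        - (\<Sum>y\<in>S. of_bool (y = x) * (\<Sum>z\<in>S. J x z) * g y) - (\<Sum>y\<in>S. \<phi> y * g y)"
      by (simp add: M_def algebra_simps sum_subtractf sum.distrib)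
    also have "(\<Sum>y\<in>S. of_bool (y = x) * (\<Sum>z\<in>S. J x z) * g y) = (\<Sum>z\<in>S. J x z) * g x"
      using that S by (simp add: of_bool_def if_distrib[of "\<lambda>t. t * _"] cong: if_cong)
    finally show ?thesis
      by (simp add: algebra_simps sum_subtractf sum_distrib_left)
  qed
  have total: "(\<Sum>x\<in>S. \<phi> x) > 0"
    using S pos by (intro sum_pos) auto
  have mean: "(\<Sum>y\<in>S. \<phi> y * g y) = 0"
    if "(\<Sum>x\<in>S. \<phi> x * (\<Sum>y\<in>S. M x y * g y)) = 0" for g
  proof -
    have "0 = (\<Sum>x\<in>S. \<phi> x * ((\<Sum>y\<in>S. J x y * (g y - g x)) - (\<Sum>y\<in>S. \<phi> y * g y)))"
      using that by (simp add: M cong: sum.cong)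
    also have "\<dots> = - (\<Sum>x\<in>S. \<phi> x) * (\<Sum>y\<in>S. \<phi> y * g y)"
      using invariant[of g] by (simp add: algebra_simps sum_subtractf sum.distrib sum_distrib_right)
    finally show ?thesis using total by auto
  qed
  have "\<exists>g. \<forall>x\<in>S. (\<Sum>y\<in>S. M x y * g y) = r x"
  proof (rule finite_system_solvable)
    fix g assume g: "\<And>x. x \<in> S \<Longrightarrow> (\<Sum>y\<in>S. M x y * g y) = 0"
    have 0: "(\<Sum>y\<in>S. \<phi> y * g y) = 0"
      by (rule mean, rule sum.neutral) (simp add: g)
    have "(\<Sum>y\<in>S. J x y * (g y - g x)) = 0" if "x \<in> S" for x
      using g[OF that] M[OF that, of g] 0 by linarith
    then obtain c where c: "\<And>x. x \<in> S \<Longrightarrow> g x = c"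
      using harmonic_constant[of g] by blast
    then have "(\<Sum>x\<in>S. \<phi> x) * c = 0"
      using 0 by (simp add: sum_distrib_right cong: sum.cong)
    then show "\<forall>y\<in>S. g y = 0" using c total by auto
  qed (use S in auto)
  then obtain g where g: "\<forall>x\<in>S. (\<Sum>y\<in>S. M x y * g y) = r x" by blast
  then have "(\<Sum>x\<in>S. \<phi> x * (\<Sum>y\<in>S. M x y * g y)) = 0"
    using mean_zero by (simp cong: sum.cong)
  then have "(\<Sum>y\<in>S. \<phi> y * g y) = 0" by (rule mean)
  then have "(\<Sum>y\<in>S. J x y * (g y - g x)) = r x" if "x \<in> S" for x
    using g[rule_format, OF that] M[OF that, of g] by linarith
  then show ?thesis by (rule that)
qed

end

text \<open>Neumann series, summed pointwise so that \<open>X\<close> may be infinite: it serves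
  both the torus resolvent and the equation for u_eps on the whole lattice. \<open>H m\<close> below
  is the m-th term.\<close>

lemma contraction_solvable:
  fixes w :: "'i \<Rightarrow> 'a \<Rightarrow> real" and t :: "'i \<Rightarrow> 'a \<Rightarrow> 'a"
  assumes I: "finite I" and c: "0 \<le> c" "c < 1"
    and w: "\<And>x. x \<in> X \<Longrightarrow> (\<Sum>i\<in>I. \<bar>w i x\<bar>) \<le> c"
    and t: "\<And>i x. i \<in> I \<Longrightarrow> x \<in> X \<Longrightarrow> t i x \<in> X"
    and h: "\<And>x. x \<in> X \<Longrightarrow> \<bar>h x\<bar> \<le> C"
  obtains g where "\<And>x. x \<in> X \<Longrightarrow> \<bar>g x\<bar> \<le> C / (1 - c)"
    and "\<And>x. x \<in> X \<Longrightarrow> g x = (\<Sum>i\<in>I. w i x * g (t i x)) + h x"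
proof -
  define H where "H = rec_nat h (\<lambda>_ g x. \<Sum>i\<in>I. w i x * g (t i x))"
  have H0: "H 0 = h" and HS: "H (Suc m) = (\<lambda>x. \<Sum>i\<in>I. w i x * H m (t i x))" for m
    by (simp_all add: H_def)
  have bound: "\<bar>H m x\<bar> \<le> c ^ m * C" if "x \<in> X" for m x
    using that
  proof (induction m arbitrary: x)
    case (Suc m)
    have C: "C \<ge> 0" using h[OF Suc.prems] by linarith
    have "\<bar>H (Suc m) x\<bar> \<le> (\<Sum>i\<in>I. \<bar>w i x\<bar> * \<bar>H m (t i x)\<bar>)"
      unfolding HS by (rule order_trans[OF sum_abs]) (simp add: abs_mult)
    also have "\<dots> \<le> (\<Sum>i\<in>I. \<bar>w i x\<bar> * (c ^ m * C))"
      using Suc t by (intro sum_mono mult_left_mono) auto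
    also have "\<dots> \<le> c * (c ^ m * C)"
      unfolding sum_distrib_right[symmetric] using w[OF Suc.prems] c C
      by (intro mult_right_mono) auto
    finally show ?case by simp
  qed (simp add: H0 h)
  have geom: "summable (\<lambda>m. c ^ m * C)"
    using c by (intro summable_mult2 summable_geometric) auto
  have summ: "summable (\<lambda>m. H m x)" if "x \<in> X" for x
    by (rule summable_comparison_test'[OF geom, of 0]) (use bound[OF that] in auto)
  define g where "g x = (\<Sum>m. H m x)" for x
  show ?thesis
  proof (rule that)
    fix x assume x: "x \<in> X"
    have "norm (g x) \<le> (\<Sum>m. c ^ m * C)"
      unfolding g_def using bound[OF x] by (intro norm_suminf_le geom) auto
    also have "(\<Sum>m. c ^ m * C) = C / (1 - c)"
      using suminf_mult2[OF summable_geometric[of c], of C] suminf_geometric[of c] c by simp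
    finally show "\<bar>g x\<bar> \<le> C / (1 - c)" by simp
    have "g x = H 0 x + (\<Sum>m. H (Suc m) x)"
      unfolding g_def using suminf_split_head[OF summ[OF x]] by simp
    also have "(\<Sum>m. H (Suc m) x) = (\<Sum>i\<in>I. \<Sum>m. w i x * H m (t i x))"
      unfolding HS using x t by (intro suminf_sum summable_mult summ) auto
    also have "\<dots> = (\<Sum>i\<in>I. w i x * g (t i x))"
      unfolding g_def using x t by (intro sum.cong refl suminf_mult summ) auto
    finally show "g x = (\<Sum>i\<in>I. w i x * g (t i x)) + h x" by (simp add: H0)
  qed
qed

section \<open>Bump functions\<close>

definition flat :: "real poly \<Rightarrow> real \<Rightarrow> real" where
  "flat p t = (if t > 0 then poly p (1 / t) * exp (- (1 / t)) else 0)"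

text \<open>With s = 1/t, the derivative of p(s) exp(-s) in t is s^2 (p(s) - p'(s)) exp(-s).\<close>

definition flat_deriv :: "real poly \<Rightarrow> real poly" where
  "flat_deriv p = [:0, 0, 1:] * (p - pderiv p)"

lemma poly_times_exp_tendsto_0: "((\<lambda>s. poly p s * exp (- s)) \<longlongrightarrow> 0) at_top" for p :: "real poly"
proof -
  have "((\<lambda>s. \<Sum>i\<le>degree p. coeff p i * (s ^ i / exp s)) \<longlongrightarrow> (\<Sum>i\<le>degree p. coeff p i * 0)) at_top"
    by (intro tendsto_sum tendsto_mult tendsto_const tendsto_power_div_exp_0)
  then show ?thesis
    by (simp add: poly_altdef exp_minus divide_inverse sum_distrib_right mult.assoc)
qed

lemma flat_has_derivative: "(flat p has_real_derivative flat (flat_deriv p) t) (at t)"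
proof -
  consider "t < 0" | "t > 0" | "t = 0" by linarith
  then show ?thesis
  proof cases
    case 1
    then have "(flat p has_real_derivative 0) (at t)"
      by (intro DERIV_cong_ev[THEN iffD2, OF refl _ refl DERIV_const[of 0]]
          eventually_mono[OF eventually_nhds_in_open[of "{..<0}"]]) (auto simp: flat_def)
    with 1 show ?thesis by (simp add: flat_def)
  next
    case 2
    have "((\<lambda>t. poly p (1 / t) * exp (- (1 / t))) has_real_derivative flat (flat_deriv p) t) (at t)"
      using 2
      by (auto intro!: derivative_eq_intros DERIV_chain2[OF poly_DERIV]
          simp: flat_def flat_deriv_def field_simps power2_eq_square)
    then show ?thesis
      by (rule has_field_derivative_transform_within_open[of _ _ _ "{0<..}"])
        (use 2 in \<open>auto simp: flat_def\<close>)
  next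
    case 3
    \<comment> \<open>With s = 1/h, the right difference quotient at 0 is s p(s) exp(-s).\<close>
    have "((\<lambda>s. poly ([:0, 1:] * p) s * exp (- s)) \<longlongrightarrow> 0) at_top"
      by (rule poly_times_exp_tendsto_0)
    then have "((\<lambda>h. poly ([:0, 1:] * p) (inverse h) * exp (- inverse h)) \<longlongrightarrow> 0) (at_right 0)"
      by (rule filterlim_compose[OF _ filterlim_inverse_at_top_right])
    then have right: "((\<lambda>h. (flat p (0 + h) - flat p 0) / h) \<longlongrightarrow> 0) (at_right 0)"
      by (rule Lim_transform_eventually)
        (auto simp: flat_def field_simps eventually_at_right_less[THEN eventually_mono])
    have left: "((\<lambda>h. (flat p (0 + h) - flat p 0) / h) \<longlongrightarrow> 0) (at_left 0)"
      by (rule Lim_transform_eventually[OF tendsto_const])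
        (auto simp: flat_def eventually_at_left_field intro!: exI[of _ "-1"])
    show ?thesis
      using right left 3 unfolding has_field_derivative_iff filterlim_at_split
      by (simp add: DERIV_def flat_def)
  qed
qed

text \<open>
  Each partial derivative of a product of such one-dimensional factors is a sum of two products of the
  same kind, so this set of functions is closed under differentiation.
\<close>

inductive_set bumps :: "(real ^ 'n::finite \<Rightarrow> real) set" where
  prod: "(\<lambda>x. \<Prod>j\<in>UNIV. flat (p j) (1 + x $ j) * flat (q j) (1 - x $ j)) \<in> bumps"
| add: "f \<in> bumps \<Longrightarrow> g \<in> bumps \<Longrightarrow> (\<lambda>x. f x + g x) \<in> bumps"

lemma bumps_scale: "f \<in> bumps \<Longrightarrow> (\<lambda>x. c * f x) \<in> bumps"
proof (induction rule: bumps.induct)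
  case (prod p q)
  \<comment> \<open>Any coordinate may absorb the constant \<open>c\<close> into its polynomial;
    index types are nonempty.\<close>
  obtain i :: 'a where True by simp
  have *: "(\<lambda>x :: real ^ 'a. c * (\<Prod>j\<in>UNIV. flat (p j) (1 + x $ j) * flat (q j) (1 - x $ j)))
     = (\<lambda>x. \<Prod>j\<in>UNIV. flat ((p(i := smult c (p i))) j) (1 + x $ j) * flat (q j) (1 - x $ j))"
    by (rule ext, subst (1 2) prod.remove[of UNIV i])
      (auto simp: flat_def mult_ac intro!: prod.cong)
  show ?case unfolding * by (rule bumps.prod)
next
  case (add f g)
  then show ?case using bumps.add by (simp add: distrib_left)
qed

lemma bumps_sum: "finite A \<Longrightarrow> A \<noteq> {} \<Longrightarrow> (\<And>i. i \<in> A \<Longrightarrow> f i \<in> bumps) \<Longrightarrow> (\<lambda>x. \<Sum>i\<in>A. f i x) \<in> bumps"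
  by (induction A rule: finite_ne_induct) (auto intro: bumps.add)

lemma partial_eq: "(f has_derivative f') (at x) \<Longrightarrow> partial i f x = f' (axis i 1)"
  unfolding partial_def by (metis frechet_derivative_at)

lemma bump_prod_has_derivative:
  fixes x :: "real ^ 'n::finite"
  shows "((\<lambda>x. \<Prod>j\<in>UNIV. flat (p j) (1 + x $ j) * flat (q j) (1 - x $ j)) has_derivative
      (\<lambda>h. \<Sum>i\<in>UNIV. h $ i * (flat (flat_deriv (p i)) (1 + x $ i) * flat (q i) (1 - x $ i)
              - flat (p i) (1 + x $ i) * flat (flat_deriv (q i)) (1 - x $ i))
         * (\<Prod>j\<in>UNIV - {i}. flat (p j) (1 + x $ j) * flat (q j) (1 - x $ j)))) (at x)"
proof (rule has_derivative_prod)
  fix i :: 'n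
  have p: "((\<lambda>x. flat (p i) (1 + x $ i)) has_derivative
      (\<lambda>h. flat (flat_deriv (p i)) (1 + x $ i) * h $ i)) (at x)"
    by (rule has_derivative_compose[OF _ flat_has_derivative[unfolded has_field_derivative_def]])
      (auto intro!: derivative_eq_intros bounded_linear_imp_has_derivative[OF bounded_linear_vec_nth])
  have q: "((\<lambda>x. flat (q i) (1 - x $ i)) has_derivative
      (\<lambda>h. flat (flat_deriv (q i)) (1 - x $ i) * (- h $ i))) (at x)"
    by (rule has_derivative_compose[OF _ flat_has_derivative[unfolded has_field_derivative_def]])
      (auto intro!: derivative_eq_intros bounded_linear_imp_has_derivative[OF bounded_linear_vec_nth])
  show "((\<lambda>x. flat (p i) (1 + x $ i) * flat (q i) (1 - x $ i)) has_derivative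
      (\<lambda>h. h $ i * (flat (flat_deriv (p i)) (1 + x $ i) * flat (q i) (1 - x $ i)
              - flat (p i) (1 + x $ i) * flat (flat_deriv (q i)) (1 - x $ i)))) (at x)"
    by (rule has_derivative_eq_rhs[OF has_derivative_mult[OF p q]]) (auto simp: algebra_simps)
qed

lemma partial_bump_prod:
  "partial i (\<lambda>x. \<Prod>j\<in>UNIV. flat (p j) (1 + x $ j) * flat (q j) (1 - x $ j)) =
    (\<lambda>x. (\<Prod>j\<in>UNIV. flat ((p(i := flat_deriv (p i))) j) (1 + x $ j) * flat (q j) (1 - x $ j))
      + (- 1) * (\<Prod>j\<in>UNIV. flat (p j) (1 + x $ j) * flat ((q(i := flat_deriv (q i))) j) (1 - x $ j)))"
  (is "?l = ?r")
proof
  fix x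
  have "?l x = (\<Sum>k\<in>UNIV. axis i 1 $ k * (flat (flat_deriv (p k)) (1 + x $ k) * flat (q k) (1 - x $ k)
              - flat (p k) (1 + x $ k) * flat (flat_deriv (q k)) (1 - x $ k))
         * (\<Prod>j\<in>UNIV - {k}. flat (p j) (1 + x $ j) * flat (q j) (1 - x $ j)))"
    by (rule partial_eq[OF bump_prod_has_derivative])
  also have "\<dots> = (flat (flat_deriv (p i)) (1 + x $ i) * flat (q i) (1 - x $ i)
              - flat (p i) (1 + x $ i) * flat (flat_deriv (q i)) (1 - x $ i))
         * (\<Prod>j\<in>UNIV - {i}. flat (p j) (1 + x $ j) * flat (q j) (1 - x $ j))"
    by (subst sum.remove[of UNIV i]) (auto simp: axis_def intro!: sum.neutral)
  also have "\<dots> = ?r x"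
    by (simp add: prod.remove[of UNIV i] algebra_simps cong: prod.cong_simp)
  finally show "?l x = ?r x" .
qed

lemma bumps_differentiable: "f \<in> bumps \<Longrightarrow> f differentiable (at x)"
  by (induction rule: bumps.induct)
    (auto intro: differentiableI[OF bump_prod_has_derivative] derivative_intros)

lemma partial_add:
  "f differentiable (at x) \<Longrightarrow> g differentiable (at x) \<Longrightarrow>
    partial i (\<lambda>x. f x + g x) x = partial i f x + partial i g x"
  by (auto simp: differentiable_def partial_eq dest: partial_eq[OF has_derivative_add])

lemma partial_scale:
  fixes f :: "real ^ 'n::finite \<Rightarrow> real"
  assumes "\<And>x. f differentiable (at x)"
  shows "partial i (\<lambda>x. c * f x) = (\<lambda>x. c * partial i f x)"
proof
  fix x
  obtain f' where "(f has_derivative f') (at x)" using assms differentiable_def by blast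
  then show "partial i (\<lambda>x. c * f x) x = c * partial i f x"
    using partial_eq[OF has_derivative_mult_right[of f f' "at x" c]] partial_eq[of f f' x] by simp
qed

lemma bumps_partial: "f \<in> bumps \<Longrightarrow> partial i f \<in> bumps"
proof (induction rule: bumps.induct)
  case (prod p q)
  show ?case unfolding partial_bump_prod
    by (intro bumps.add bumps_scale bumps.prod)
next
  case (add f g)
  have "partial i (\<lambda>x. f x + g x) = (\<lambda>x. partial i f x + partial i g x)"
    using add by (auto intro: partial_add bumps_differentiable)
  then show ?case using add by (auto intro: bumps.add)
qed

lemma bumps_continuous: "f \<in> bumps \<Longrightarrow> continuous_on A f"
  by (meson bumps_differentiable continuous_at_imp_continuous_on differentiable_imp_continuous_within)

lemma bumps_cont_diff: "f \<in> bumps \<Longrightarrow> cont_diff k f"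
  by (induction k arbitrary: f) (auto simp: bumps_continuous bumps_differentiable bumps_partial)

lemma bumps_vanish: "f \<in> bumps \<Longrightarrow> \<bar>x $ j\<bar> \<ge> 1 \<Longrightarrow> f x = 0"
proof (induction rule: bumps.induct)
  case (prod p q)
  then show ?case by (intro prod_zero bexI[of _ j]) (auto simp: flat_def)
qed auto

lemma bumps_support:
  assumes "f \<in> bumps" "f x \<noteq> 0" shows "x \<in> cbox (\<chi> j. -1) (\<chi> j. 1)"
proof -
  have "\<bar>x $ j\<bar> < 1" for j
    using bumps_vanish[OF assms(1), of x j] assms(2) by linarith
  then show ?thesis
    by (simp add: mem_box_cart abs_less_iff less_imp_le minus_le_iff)
qed

lemma bumps_compactly_supported:
  assumes "f \<in> bumps" shows "compactly_supported f"
proof -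
  have "{x. f x \<noteq> 0} \<subseteq> cbox (\<chi> j. -1) (\<chi> j. 1)"
    using bumps_support[OF assms] by blast
  then have "bounded {x. f x \<noteq> 0}"
    using bounded_cbox bounded_subset by blast
  then show ?thesis
    unfolding compactly_supported_def by (simp add: compact_closure)
qed

lemma bumps_bounded:
  assumes "f \<in> bumps" shows "bounded (range f)"
proof -
  define B :: "(real ^ 'a) set" where "B = cbox (\<chi> j. -1) (\<chi> j. 1)"
  have "range f \<subseteq> f ` B \<union> {0}"
    using bumps_support[OF assms] unfolding B_def by blast
  moreover have "bounded (f ` B)"
    unfolding B_def by (intro compact_imp_bounded compact_continuous_image bumps_continuous assms compact_cbox)
  ultimately show ?thesis by (meson bounded_Un bounded_insert bounded_empty bounded_subset)
qed

section \<open>An explicit bump and its expansion at the origin\<close>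

text \<open>On the open unit cube this is the product of exp(-2 / (1 - x_j^2)), since 1/(1+t) +
  1/(1-t) = 2/(1-t^2).\<close>

definition std_bump :: "real ^ 'n::finite \<Rightarrow> real" where
  "std_bump x = (\<Prod>j\<in>UNIV. flat 1 (1 + x $ j) * flat 1 (1 - x $ j))"

lemma std_bump_in_bumps: "std_bump \<in> bumps"
  using bumps.prod[of "\<lambda>_. 1" "\<lambda>_. 1"] by (simp add: std_bump_def[abs_def])

lemma std_bump_0: "std_bump (0 :: real ^ 'n::finite) = exp (- 2 * real CARD('n))"
proof -
  have "exp (- 1) * exp (- 1) = (exp (- 2) :: real)" by (simp flip: exp_add)
  then show ?thesis
    using exp_of_nat_mult[of "CARD('n)" "- 2 :: real"] by (simp add: std_bump_def flat_def mult.commute)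
qed

text \<open>At s = 1 the polynomials 1, \<open>flat_deriv 1\<close> and its own
  \<open>flat_deriv\<close> take the values 1, 1 and -1, so the second derivative contributes the
  factor -1 - 2 - 1 = -4.\<close>

lemma partial_partial_std_bump_0:
  "partial i (partial i std_bump) (0 :: real ^ 'n::finite) = - 4 * std_bump (0 :: real ^ 'n)"
proof -
  let ?P = "\<lambda>p q (x :: real ^ 'n). \<Prod>j\<in>UNIV. flat (p j) (1 + x $ j) * flat (q j) (1 - x $ j)"
  let ?c = "\<lambda>_ :: 'n. 1 :: real poly"
  let ?D = "flat_deriv 1"
  have 1: "partial i std_bump = (\<lambda>x. ?P (?c(i := ?D)) ?c x + (- 1) * ?P ?c (?c(i := ?D)) x)"
    unfolding std_bump_def[abs_def] by (rule partial_bump_prod)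
  have 2: "partial i (partial i std_bump) x = ?P (?c(i := flat_deriv ?D)) ?c x
      - 2 * ?P (?c(i := ?D)) (?c(i := ?D)) x + ?P ?c (?c(i := flat_deriv ?D)) x" for x
    unfolding 1
    by (subst partial_add, (intro bumps_differentiable bumps.prod bumps_scale)+,
        subst partial_scale, (intro bumps_differentiable bumps.prod), subst (1 2) partial_bump_prod) simp
  have factor: "?P (?c(i := p)) (?c(i := q)) 0 = poly p 1 * poly q 1 * std_bump (0 :: real ^ 'n)" for p q
    unfolding std_bump_def
    by (subst (1 2) prod.remove[of UNIV i]) (auto simp: flat_def intro!: prod.cong)
  show ?thesis
    unfolding 2 using factor[of "flat_deriv ?D" 1] factor[of ?D ?D] factor[of 1 "flat_deriv ?D"]
    by (simp add: flat_deriv_def pderiv_pCons)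
qed

text \<open>Writing the bump as its value at 0 times exp(-(2N + s)), with N the squared norm and s
  of fourth order, makes the remainder explicit. The constant is 20 = 4 + 16, from s \<le> 4N^2 and
  from the quadratic error w^2 \<le> 16N^2 of exp(-w) at w = 2N + s.\<close>

lemma std_bump_taylor:
  fixes x :: "real ^ 'n::finite"
  assumes "(norm x)\<^sup>2 \<le> 1 / 2"
  shows "\<bar>std_bump x - std_bump (0 :: real ^ 'n) * (1 - 2 * (norm x)\<^sup>2)\<bar>
      \<le> 20 * std_bump (0 :: real ^ 'n) * (norm x) ^ 4"
proof -
  define N where "N = (norm x)\<^sup>2"
  have N: "N = (\<Sum>j\<in>UNIV. (x $ j)\<^sup>2)"
    by (simp add: N_def norm_vec_def L2_set_def sum_nonneg)
  have le: "(x $ j)\<^sup>2 \<le> N" for j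
    unfolding N by (rule member_le_sum) auto
  have half: "(x $ j)\<^sup>2 \<le> 1 / 2" for j
    using le[of j] assms by (simp add: N_def)
  have abs: "\<bar>x $ j\<bar> < 1" for j
    using half[of j] abs_square_less_1[of "x $ j"] by linarith
  \<comment> \<open>The exact remainder in -2/(1 - t^2) = -2 - 2t^2 - 2t^4/(1 - t^2), summed over
    the coordinates.\<close>
  define s where "s = (\<Sum>j\<in>UNIV. 2 * (x $ j) ^ 4 / (1 - (x $ j)\<^sup>2))"
  have s0: "s \<ge> 0"
    unfolding s_def using half by (intro sum_nonneg) (auto intro!: divide_nonneg_nonneg simp: order_trans[OF half])
  have "s \<le> (\<Sum>j\<in>UNIV. 4 * N * (x $ j)\<^sup>2)"
    unfolding s_def
  proof (rule sum_mono)
    fix j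
    have "2 * (x $ j) ^ 4 / (1 - (x $ j)\<^sup>2) \<le> 2 * (x $ j) ^ 4 / (1 / 2)"
      using half[of j] by (intro divide_left_mono) auto
    also have "\<dots> = 4 * ((x $ j)\<^sup>2 * (x $ j)\<^sup>2)" by (simp add: power2_eq_square power4_eq_xxxx)
    also have "\<dots> \<le> 4 * (N * (x $ j)\<^sup>2)" using le[of j] by (intro mult_left_mono mult_right_mono) auto
    finally show "2 * (x $ j) ^ 4 / (1 - (x $ j)\<^sup>2) \<le> 4 * N * (x $ j)\<^sup>2" by simp
  qed
  also have "\<dots> = 4 * N\<^sup>2" by (simp add: N power2_eq_square flip: sum_distrib_left)
  finally have s: "s \<le> 4 * N\<^sup>2" .
  have bump: "std_bump x = std_bump (0 :: real ^ 'n) * exp (- (2 * N + s))"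
  proof -
    have "flat 1 (1 + x $ j) * flat 1 (1 - x $ j)
        = exp (- 2) * exp (- (2 * (x $ j)\<^sup>2 + 2 * (x $ j) ^ 4 / (1 - (x $ j)\<^sup>2)))" for j
    proof -
      have ne: "1 + x $ j > 0" "1 - x $ j > 0" "1 - (x $ j)\<^sup>2 > 0"
        using abs[of j] half[of j] by auto
      have "- (1 / (1 + x $ j)) - 1 / (1 - x $ j) = - 2 - (2 * (x $ j)\<^sup>2 + 2 * (x $ j) ^ 4 / (1 - (x $ j)\<^sup>2))"
        using ne by (simp add: divide_simps power2_eq_square power4_eq_xxxx) (simp add: algebra_simps)
      then show ?thesis
        using ne by (simp add: flat_def flip: exp_add)
    qed
    then have "std_bump x = exp (- 2) ^ CARD('n) *
        exp (\<Sum>j\<in>UNIV. - (2 * (x $ j)\<^sup>2 + 2 * (x $ j) ^ 4 / (1 - (x $ j)\<^sup>2)))"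
      by (simp add: std_bump_def prod.distrib exp_sum)
    also have "(\<Sum>j\<in>UNIV. - (2 * (x $ j)\<^sup>2 + 2 * (x $ j) ^ 4 / (1 - (x $ j)\<^sup>2))) = - (2 * N + s)"
      unfolding N s_def sum_negf sum.distrib sum_distrib_left ..
    also have "exp (- 2) ^ CARD('n) = std_bump (0 :: real ^ 'n)"
      using exp_of_nat_mult[of "CARD('n)" "- 2 :: real"] by (simp add: std_bump_0 mult.commute)
    finally show ?thesis .
  qed
  define w where "w = 2 * N + s"
  have N0: "N \<ge> 0" "N \<le> 1 / 2" using assms by (auto simp: N_def)
  have w: "0 \<le> w" "w \<le> 4 * N"
    using s s0 N0 mult_left_mono[OF N0(2) N0(1)] by (auto simp: w_def power2_eq_square)
  have "exp (- w) \<ge> 1 - w" using exp_ge_add_one_self[of "- w"] by simp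
  moreover have "exp (- w) \<le> 1 - w + w\<^sup>2"
  proof -
    have "exp (- w) \<le> 1 / (1 + w)"
      using exp_ge_add_one_self[of w] w by (simp add: exp_minus field_simps)
    also have "\<dots> \<le> 1 - w + w\<^sup>2"
      using w by (simp add: field_simps power2_eq_square power3_eq_cube)
    finally show ?thesis .
  qed
  moreover have "w\<^sup>2 \<le> 16 * N\<^sup>2"
    using power_mono[OF w(2,1), of 2] by (simp add: power_mult_distrib)
  ultimately have "\<bar>exp (- w) - (1 - 2 * N)\<bar> \<le> 20 * N\<^sup>2"
    using s s0 unfolding w_def by (simp add: abs_le_iff)
  then have "std_bump (0 :: real ^ 'n) * \<bar>exp (- w) - (1 - 2 * N)\<bar> \<le> std_bump (0 :: real ^ 'n) * (20 * N\<^sup>2)"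
    by (intro mult_left_mono) (auto simp: std_bump_0)
  moreover have "std_bump (0 :: real ^ 'n) * \<bar>exp (- w) - (1 - 2 * N)\<bar>
      = \<bar>std_bump x - std_bump (0 :: real ^ 'n) * (1 - 2 * N)\<bar>"
    unfolding bump w_def[symmetric] by (simp add: std_bump_0 abs_mult flip: right_diff_distrib)
  ultimately show ?thesis by (simp add: N_def flip: power_mult)
qed

section \<open>The torus and the reflected walk\<close>

lemma axis_minus: "axis j (- s) = - axis j (s :: int)" for j :: "'n::finite"
  by (auto simp: axis_def vec_eq_iff)

text \<open>Walk from 0 to \<open>k\<close> along one axis at a time; in the inner induction
  \<open>J\<close> is the set of coordinates already adjusted.\<close>

lemma lattice_connected:
  fixes k :: "int ^ 'n::finite"
  assumes 0: "0 \<in> W"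
    and plus: "\<And>k j. k \<in> W \<Longrightarrow> k + axis j 1 \<in> W"
    and minus: "\<And>k j. k \<in> W \<Longrightarrow> k - axis j 1 \<in> W"
  shows "k \<in> W"
proof -
  have line: "k + axis j m \<in> W" if "k \<in> W" for k :: "int ^ 'n" and j m
  proof (induction m rule: int_induct[where k = 0])
    case base
    have "axis j 0 = (0 :: int ^ 'n)" by (auto simp: axis_def vec_eq_iff)
    with that show ?case by (metis add.right_neutral)
  next
    case (step1 m)
    have "k + axis j m + axis j 1 = k + axis j (m + 1)" by (auto simp: axis_def vec_eq_iff)
    with plus[OF step1(2), of j] show ?case by simp
  next
    case (step2 m)
    have "k + axis j m - axis j 1 = k + axis j (m - 1)" by (auto simp: axis_def vec_eq_iff)
    with minus[OF step2(2), of j] show ?case by simp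
  qed
  have "(\<chi> j. if j \<in> J then k $ j else 0) \<in> W" for J
    using finite[of J]
  proof (induction J rule: finite_induct)
    case empty
    have "(\<chi> j. if j \<in> {} then k $ j else 0) = 0" by (simp add: vec_eq_iff)
    with 0 show ?case by metis
  next
    case (insert i J)
    have "(\<chi> j. if j \<in> insert i J then k $ j else 0)
        = (\<chi> j. if j \<in> J then k $ j else 0) + axis i (k $ i)"
      using insert.hyps by (auto simp: axis_def vec_eq_iff)
    with line[OF insert.IH, of i "k $ i"] show ?case by metis
  qed
  from this[of UNIV] show ?thesis by simp
qed

section \<open>The torus as a quotient of the lattice, and the resolvent of its Laplacian\<close>

locale torus_setup =
  fixes i1 :: "'n::finite" and ell :: "'n \<Rightarrow> nat"
  assumes ell: "j \<noteq> i1 \<Longrightarrow> ell j \<ge> 1"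
begin

abbreviation "T \<equiv> torus i1 ell"
abbreviation "shift \<equiv> torus_add i1 ell"
abbreviation "lap \<equiv> laplacian i1 ell"

lemma shift_in_torus: "shift y x \<in> T"
  using ell by (fastforce simp: torus_def torus_add_def)

lemma shift_shift: "shift (shift y x) z = shift y (x + z)"
  by (auto simp: torus_add_def vec_eq_iff mod_add_left_eq add.assoc)

lemma shift_0: "y \<in> T \<Longrightarrow> shift y 0 = y"
  by (auto simp: torus_add_def torus_def vec_eq_iff)

lemma shift_axis_i1: "shift y (x + axis i1 s) = shift y x"
  by (auto simp: torus_add_def axis_def vec_eq_iff)

lemma shift_eq_iff: "y \<in> T \<Longrightarrow> y' \<in> T \<Longrightarrow> y' = shift y x \<longleftrightarrow> y = shift y' (- x)"
  by (metis shift_shift shift_0 add.right_inverse add.left_inverse)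

lemma finite_torus: "finite T"
proof -
  have "T \<subseteq> (\<lambda>f. \<chi> j. f j) ` (\<Pi>\<^sub>E j\<in>UNIV. insert 0 {0..<int (ell j)})"
  proof
    fix y assume "y \<in> T"
    then show "y \<in> (\<lambda>f. \<chi> j. f j) ` (\<Pi>\<^sub>E j\<in>UNIV. insert 0 {0..<int (ell j)})"
      by (intro image_eqI[of _ _ "\<lambda>j. y $ j"]) (auto simp: torus_def)
  qed
  then show ?thesis by (rule finite_subset) (intro finite_imageI finite_PiE; simp)
qed

lemma zero_in_torus: "0 \<in> T"
  using ell by (fastforce simp: torus_def)

text \<open>Pull \<open>Z\<close> back to the lattice by \<open>k \<mapsto> shift y0 k\<close>.
  Steps in direction \<open>i1\<close> fix the torus point, so the pullback is closed under steps in
  all directions.\<close>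

lemma torus_connected:
  assumes "Z \<subseteq> T" "Z \<noteq> {}"
    and plus: "\<And>y j. j \<noteq> i1 \<Longrightarrow> y \<in> Z \<Longrightarrow> shift y (axis j 1) \<in> Z"
    and minus: "\<And>y j. j \<noteq> i1 \<Longrightarrow> y \<in> Z \<Longrightarrow> shift y (- axis j 1) \<in> Z"
  shows "Z = T"
proof -
  obtain y0 where y0: "y0 \<in> Z" "y0 \<in> T" using assms by blast
  have shift_i1: "shift y (- axis i1 1) = y" "shift y (axis i1 1) = y" if "y \<in> T" for y
    using shift_axis_i1[of y 0 "- 1"] shift_axis_i1[of y 0 1] that by (simp_all add: shift_0 axis_minus)
  have "k \<in> {k. shift y0 k \<in> Z}" for k
  proof (rule lattice_connected)
    fix k j assume k: "k \<in> {k. shift y0 k \<in> Z}"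
    show "k + axis j 1 \<in> {k. shift y0 k \<in> Z}"
      using k plus[of j "shift y0 k"] shift_i1 shift_in_torus
      by (cases "j = i1") (auto simp flip: shift_shift)
    have "shift (shift y0 k) (- axis j 1) \<in> Z"
      using k minus[of j "shift y0 k"] shift_i1 shift_in_torus
      by (cases "j = i1") auto
    then show "k - axis j 1 \<in> {k. shift y0 k \<in> Z}" by (simp add: shift_shift)
  qed (use y0 shift_0 in simp)
  then have "shift y0 (y - y0) \<in> Z" for y by simp
  moreover have "shift y0 (y - y0) = y" if "y \<in> T" for y
    using that by (auto simp: torus_add_def torus_def vec_eq_iff)
  ultimately show ?thesis using assms(1) by (metis subset_antisym subsetI)
qed

lemma lap_eq: "lap g y = (\<Sum>j\<in>UNIV - {i1}. g (shift y (axis j 1)) + g (shift y (- axis j 1)))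
    - 2 * real (card (UNIV - {i1})) * g y"
  by (simp add: laplacian_def sum_subtractf)

lemma lap_add: "lap (\<lambda>y. f y + g y) y = lap f y + lap g y"
  by (simp add: laplacian_def flip: sum.distrib) (simp add: algebra_simps)

lemma lap_scale: "lap (\<lambda>y. c * f y) y = c * lap f y"
  by (simp add: laplacian_def sum_distrib_left algebra_simps)

lemma lap_uminus: "lap (\<lambda>y. - f y) y = - lap f y"
  using lap_scale[of "- 1"] by simp

lemma lap_diff: "lap (\<lambda>y. f y - g y) y = lap f y - lap g y"
  using lap_add[of f "\<lambda>y. - g y"] by (simp add: lap_uminus)

lemma lap_cong: "(\<And>y. y \<in> T \<Longrightarrow> f y = g y) \<Longrightarrow> y \<in> T \<Longrightarrow> lap f y = lap g y"
  by (simp add: laplacian_def shift_in_torus)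

lemma lap_const: "lap (\<lambda>_. c) y = 0"
  by (simp add: laplacian_def)

text \<open>With m transverse directions the equation reads (4 + 2m) g = (sum over the 2m
  neighbours) + h, a fixed point problem with contraction factor 2m/(4 + 2m). Pairs (direction,
  sign) index the neighbours.\<close>

lemma neg_laplacian_plus_4_solvable:
  obtains g where "\<And>y. y \<in> T \<Longrightarrow> 4 * g y - lap g y = h y"
proof -
  define m where "m = real (card (UNIV - {i1}))"
  define I where "I = (UNIV - {i1}) \<times> {1, - 1 :: int}"
  have m: "m \<ge> 0" by (simp add: m_def)
  have I_sum: "(\<Sum>(j, s)\<in>I. F j s) = (\<Sum>j\<in>UNIV - {i1}. F j 1 + F j (- 1))" for F :: "'n \<Rightarrow> int \<Rightarrow> real"
    unfolding I_def by (subst sum.cartesian_product[symmetric]) simp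
  have const: "(\<Sum>i\<in>I. c) = 2 * m * c" for c :: real
    using I_sum[of "\<lambda>_ _. c"] by (auto simp: m_def split_def algebra_simps)
  define C where "C = Max ((\<lambda>y. \<bar>h y / (4 + 2 * m)\<bar>) ` T)"
  have C: "\<bar>h y / (4 + 2 * m)\<bar> \<le> C" if "y \<in> T" for y
    unfolding C_def using that finite_torus by (intro Max_ge) auto
  have weights: "(\<Sum>i\<in>I. \<bar>1 / (4 + 2 * m)\<bar>) \<le> 2 * m / (4 + 2 * m)"
    unfolding const using m by simp
  obtain g where "\<And>y. y \<in> T \<Longrightarrow> g y =
      (\<Sum>i\<in>I. 1 / (4 + 2 * m) * g (shift y (axis (fst i) (snd i)))) + h y / (4 + 2 * m)"
    by (rule contraction_solvable[of I "2 * m / (4 + 2 * m)" T "\<lambda>_ _. 1 / (4 + 2 * m)"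
          "\<lambda>i y. shift y (axis (fst i) (snd i))" "\<lambda>y. h y / (4 + 2 * m)" C, OF _ _ _ weights])
      (use m C shift_in_torus in \<open>auto simp: I_def\<close>)
  moreover have "(\<Sum>i\<in>I. 1 / (4 + 2 * m) * g (shift y (axis (fst i) (snd i))))
      = (lap g y + 2 * m * g y) / (4 + 2 * m)" for y
    using I_sum[of "\<lambda>j s. g (shift y (axis j s)) / (4 + 2 * m)"]
    by (simp add: lap_eq m_def split_def axis_minus sum_divide_distrib add_divide_distrib)
  ultimately have "4 * g y - lap g y = h y" if "y \<in> T" for y
    using that m by (simp add: field_simps)
  then show ?thesis by (rule that)
qed

text \<open>At a maximum the Laplacian is nonpositive, so 4 times the maximum is too; apply this to
  \<open>g\<close> and \<open>- g\<close>.\<close>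

lemma neg_laplacian_plus_4_injective:
  assumes g: "\<And>y. y \<in> T \<Longrightarrow> 4 * g y - lap g y = 0" and y: "y \<in> T"
  shows "g y = 0"
proof -
  have nonpos: "f y \<le> 0" if f: "\<And>y. y \<in> T \<Longrightarrow> 4 * f y - lap f y = 0" "y \<in> T" for f y
  proof -
    obtain z where z: "z \<in> T" "\<And>y. y \<in> T \<Longrightarrow> f y \<le> f z"
      using Max_in[of "f ` T"] Max_ge[of "f ` T"] finite_torus y
      by (smt (verit, best) empty_iff finite_imageI imageE imageI image_is_empty)
    have "lap f z \<le> 0"
      unfolding laplacian_def using z shift_in_torus
      by (intro sum_nonpos) (smt (verit))
    with f(1)[OF z(1)] z(2)[OF f(2)] show ?thesis by simp
  qed
  from nonpos[of g y] nonpos[of "\<lambda>y. - g y" y] g y show ?thesis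
    by (simp add: lap_uminus)
qed

text \<open>Injectivity and solvability on extensional functions are what give
  \<open>the_inv_into\<close> its meaning; later proofs use only this equation.\<close>

lemma inv_neg_laplacian_plus_4:
  assumes y: "y \<in> T"
  shows "4 * inv_neg_laplacian_plus_4 i1 ell h y - lap (inv_neg_laplacian_plus_4 i1 ell h) y = h y"
proof -
  let ?A = "neg_laplacian_plus_4 i1 ell" and ?E = "extensional T"
  have "inj_on ?A ?E"
  proof (rule inj_onI)
    fix f g assume fg: "f \<in> ?E" "g \<in> ?E" "?A f = ?A g"
    have "4 * (f y - g y) - lap (\<lambda>y. f y - g y) y = 0" if "y \<in> T" for y
      using fun_cong[OF fg(3), of y] that by (simp add: neg_laplacian_plus_4_def lap_diff)
    then have "f y - g y = 0" if "y \<in> T" for y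
      using that by (rule neg_laplacian_plus_4_injective)
    then show "f = g" using fg(1,2) by (intro extensionalityI) auto
  qed
  moreover obtain g where g: "\<And>y. y \<in> T \<Longrightarrow> 4 * g y - lap g y = h y"
    using neg_laplacian_plus_4_solvable[of h] by blast
  have "?A (restrict g T) = restrict h T"
  proof
    fix y
    show "?A (restrict g T) y = restrict h T y"
      using g[of y] lap_cong[of "restrict g T" g y] by (auto simp: neg_laplacian_plus_4_def)
  qed
  then have "restrict h T \<in> ?A ` ?E"
    by (metis image_eqI restrict_extensional)
  ultimately have "?A (inv_neg_laplacian_plus_4 i1 ell h) = restrict h T"
    unfolding inv_neg_laplacian_plus_4_def by (rule f_the_inv_into_f)
  from fun_cong[OF this, of y] y show ?thesis
    by (simp add: neg_laplacian_plus_4_def)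
qed

end

section \<open>Jump rates, irreducibility and generator of the reflected walk\<close>

locale reflected_walk = torus_setup i1 ell for i1 :: "'n::finite" and ell +
  fixes L :: nat and b :: "int \<times> (int ^ 'n) \<Rightarrow> real" and \<sigma> :: real
  assumes L: "L \<ge> 1"
    and \<sigma>: "\<sigma> = 1 / (2 * real CARD('n))"
    and drift: "\<omega> \<in> Omega i1 L ell \<Longrightarrow> \<bar>b \<omega>\<bar> < \<sigma>"
    and odd_drift: "1 \<le> n \<Longrightarrow> n \<le> 2 * int L \<Longrightarrow> y \<in> torus i1 ell \<Longrightarrow>
           b (2 * int L + 1 - n, y) = - b (n, y)"
begin

abbreviation "hat \<equiv> Omega_hat i1 L ell"
abbreviation "rate \<equiv> jump_rate i1 ell b"

lemma \<sigma>_pos: "\<sigma> > 0" by (simp add: \<sigma>)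

lemma in_hat: "(n, y) \<in> hat \<longleftrightarrow> 1 \<le> n \<and> n \<le> int L \<and> y \<in> T"
  by (auto simp: Omega_hat_def)

lemma finite_hat: "finite hat" by (simp add: Omega_hat_def finite_torus)

lemma hat_nonempty: "hat \<noteq> {}"
  using in_hat[of 1 0] zero_in_torus L by auto

lemma drift_hat: "(n, y) \<in> hat \<Longrightarrow> \<bar>b (n, y)\<bar> < \<sigma>"
  by (rule drift) (auto simp: Omega_hat_def Omega_def)

lemma rate_eq: "rate (n, y) \<omega> = \<sigma> * (\<Sum>j\<in>UNIV - {i1}.
       of_bool (\<omega> = (n, shift y (axis j 1))) + of_bool (\<omega> = (n, shift y (- axis j 1))))
     + (\<sigma> + b (n, y)) * of_bool (\<omega> = (n + 1, y)) + (\<sigma> - b (n, y)) * of_bool (\<omega> = (n - 1, y))"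
  by (simp add: jump_rate_def \<sigma> sum_distrib_left algebra_simps)

lemma sum_of_bool_hat: "(\<Sum>\<omega>\<in>hat. of_bool (\<omega> = z) * h \<omega>) = of_bool (z \<in> hat) * h z" for h :: "_ \<Rightarrow> real"
  using finite_hat by (simp add: of_bool_def if_distrib[of "\<lambda>t. t * _"] cong: if_cong)

lemma sum_rate_out:
  assumes "(n, y) \<in> hat"
  shows "(\<Sum>\<omega>\<in>hat. rate (n, y) \<omega> * h \<omega>) =
    \<sigma> * (\<Sum>j\<in>UNIV - {i1}. h (n, shift y (axis j 1)) + h (n, shift y (- axis j 1)))
    + of_bool (n < int L) * (\<sigma> + b (n, y)) * h (n + 1, y)
    + of_bool (1 < n) * (\<sigma> - b (n, y)) * h (n - 1, y)"
proof -
  have "(\<Sum>\<omega>\<in>hat. rate (n, y) \<omega> * h \<omega>) =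
     \<sigma> * (\<Sum>j\<in>UNIV - {i1}. (\<Sum>\<omega>\<in>hat. of_bool (\<omega> = (n, shift y (axis j 1))) * h \<omega>)
       + (\<Sum>\<omega>\<in>hat. of_bool (\<omega> = (n, shift y (- axis j 1))) * h \<omega>))
     + (\<sigma> + b (n, y)) * (\<Sum>\<omega>\<in>hat. of_bool (\<omega> = (n + 1, y)) * h \<omega>)
     + (\<sigma> - b (n, y)) * (\<Sum>\<omega>\<in>hat. of_bool (\<omega> = (n - 1, y)) * h \<omega>)"
    by (simp only: rate_eq distrib_right sum_distrib_right mult.assoc sum.distrib
        sum_distrib_left[symmetric] sum.swap[of _ "UNIV - {i1}" hat])
  with assms show ?thesis
    unfolding sum_of_bool_hat by (auto simp: in_hat shift_in_torus)
qed

text \<open>Transpose of \<open>sum_rate_out\<close>: transverse jumps are symmetric, while those in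
  direction \<open>i1\<close> carry the drift at their starting point.\<close>

lemma sum_rate_in:
  assumes "(n, y) \<in> hat"
  shows "(\<Sum>\<omega>\<in>hat. h \<omega> * rate \<omega> (n, y)) =
    \<sigma> * (\<Sum>j\<in>UNIV - {i1}. h (n, shift y (axis j 1)) + h (n, shift y (- axis j 1)))
    + of_bool (1 < n) * (\<sigma> + b (n - 1, y)) * h (n - 1, y)
    + of_bool (n < int L) * (\<sigma> - b (n + 1, y)) * h (n + 1, y)"
proof -
  have rate: "rate \<omega> (n, y) = \<sigma> * (\<Sum>j\<in>UNIV - {i1}.
       of_bool (\<omega> = (n, shift y (- axis j 1))) + of_bool (\<omega> = (n, shift y (axis j 1))))
     + of_bool (\<omega> = (n - 1, y)) * (\<sigma> + b \<omega>) + of_bool (\<omega> = (n + 1, y)) * (\<sigma> - b \<omega>)"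
    if "\<omega> \<in> hat" for \<omega>
  proof -
    obtain m z where \<omega>: "\<omega> = (m, z)" by fastforce
    have "((n, y) = (m, shift z (axis j 1))) = ((m, z) = (n, shift y (- axis j 1)))"
      "((n, y) = (m, shift z (- axis j 1))) = ((m, z) = (n, shift y (axis j 1)))" for j
      using that assms shift_eq_iff[of z y] by (auto simp: \<omega> in_hat)
    moreover have "((n, y) = (m + 1, z)) = ((m, z) = (n - 1, y))" "((n, y) = (m - 1, z)) = ((m, z) = (n + 1, y))"
      by auto
    ultimately show ?thesis
      by (simp only: \<omega> rate_eq mult.commute[of "of_bool _"])
  qed
  have "(\<Sum>\<omega>\<in>hat. h \<omega> * rate \<omega> (n, y)) =
     \<sigma> * (\<Sum>j\<in>UNIV - {i1}. (\<Sum>\<omega>\<in>hat. of_bool (\<omega> = (n, shift y (- axis j 1))) * h \<omega>)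
       + (\<Sum>\<omega>\<in>hat. of_bool (\<omega> = (n, shift y (axis j 1))) * h \<omega>))
     + (\<Sum>\<omega>\<in>hat. of_bool (\<omega> = (n - 1, y)) * ((\<sigma> + b \<omega>) * h \<omega>))
     + (\<Sum>\<omega>\<in>hat. of_bool (\<omega> = (n + 1, y)) * ((\<sigma> - b \<omega>) * h \<omega>))"
    by (simp only: rate mult.commute[of "h _"] distrib_right sum_distrib_right mult.assoc sum.distrib
        sum_distrib_left[symmetric] sum.swap[of _ "UNIV - {i1}" hat] cong: sum.cong)
  with assms show ?thesis
    unfolding sum_of_bool_hat by (auto simp: in_hat shift_in_torus algebra_simps)
qed

lemma rate_nonneg: "\<omega> \<in> hat \<Longrightarrow> rate \<omega> \<omega>' \<ge> 0"
  using \<sigma>_pos drift_hat by (cases \<omega>) (fastforce simp: rate_eq abs_less_iff intro!: add_nonneg_nonneg mult_nonneg_nonneg sum_nonneg)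

text \<open>Since |b| < \<sigma> strictly, every nearest-neighbour rate inside \<open>hat\<close> is
  positive. A closed set therefore contains the whole row of any of its points by
  \<open>torus_connected\<close>, and then all rows above and below.\<close>

sublocale connected_kernel hat rate
proof
  show "finite hat" "hat \<noteq> {}" by (rule finite_hat hat_nonempty)+
  show "rate x y \<ge> 0" if "x \<in> hat" "y \<in> hat" for x y using that by (simp add: rate_nonneg)
next
  fix Z assume Z: "Z \<subseteq> hat" "Z \<noteq> {}"
    and closed: "\<And>x y. x \<in> Z \<Longrightarrow> y \<in> hat \<Longrightarrow> rate x y > 0 \<Longrightarrow> y \<in> Z"
  have sum0: "(\<Sum>j\<in>UNIV - {i1}. of_bool (P j) + of_bool (Q j)) \<ge> (0 :: real)" for P Q
    by (intro sum_nonneg) auto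
  have up: "(n + 1, y) \<in> Z" if "(n, y) \<in> Z" "n < int L" for n y
  proof (rule closed[OF that(1)])
    have "(n, y) \<in> hat" using that Z by auto
    then show "(n + 1, y) \<in> hat" "rate (n, y) (n + 1, y) > 0"
      using that drift_hat[of n y] \<sigma>_pos sum0
      by (auto simp: in_hat rate_eq intro!: add_nonneg_pos mult_nonneg_nonneg)
  qed
  have down: "(n - 1, y) \<in> Z" if "(n, y) \<in> Z" "1 < n" for n y
  proof (rule closed[OF that(1)])
    have "(n, y) \<in> hat" using that Z by auto
    then show "(n - 1, y) \<in> hat" "rate (n, y) (n - 1, y) > 0"
      using that drift_hat[of n y] \<sigma>_pos sum0
      by (auto simp: in_hat rate_eq intro!: add_nonneg_pos mult_nonneg_nonneg)
  qed
  have side: "(n, shift y x) \<in> Z" if "(n, y) \<in> Z" "j \<noteq> i1" "x = axis j 1 \<or> x = - axis j 1" for n y j x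
  proof (rule closed[OF that(1)])
    have hat: "(n, y) \<in> hat" using that Z by auto
    then show "(n, shift y x) \<in> hat"
      by (auto simp: in_hat shift_in_torus)
    have "(\<Sum>j\<in>UNIV - {i1}. of_bool ((n, shift y x) = (n, shift y (axis j 1)))
        + of_bool ((n, shift y x) = (n, shift y (- axis j 1)))) > (0 :: real)"
      using that by (intro sum_pos2[of _ j]) auto
    then show "rate (n, y) (n, shift y x) > 0"
      using drift_hat[OF hat] \<sigma>_pos unfolding rate_eq by (intro add_pos_nonneg mult_pos_pos) auto
  qed
  obtain n0 y0 where 0: "(n0, y0) \<in> Z" using Z by fastforce
  then have n0: "1 \<le> n0" "n0 \<le> int L" using Z by (auto simp: in_hat)
  have "{y. (n0, y) \<in> Z} = T"
    using Z 0 side by (intro torus_connected) (auto simp: in_hat)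
  then have row: "(n0, y) \<in> Z" if "y \<in> T" for y using that by auto
  have "(n, y) \<in> Z" if "(n, y) \<in> hat" for n y
  proof (cases "n0 \<le> n")
    case True
    have "n \<le> int L \<longrightarrow> (n, y) \<in> Z"
      using True by (induction n rule: int_ge_induct) (use row that up in \<open>auto simp: in_hat\<close>)
    with that show ?thesis by (simp add: in_hat)
  next
    case False
    then have "n \<le> n0" by simp
    then have "1 \<le> n \<longrightarrow> (n, y) \<in> Z"
      by (induction n rule: int_le_induct) (use row that down in \<open>auto simp: in_hat\<close>)
    with that show ?thesis by (simp add: in_hat)
  qed
  with Z show "Z = hat" by auto
qed

definition generator :: "(int \<times> (int ^ 'n) \<Rightarrow> real) \<Rightarrow> int \<times> (int ^ 'n) \<Rightarrow> real" where
  "generator g \<omega> = (\<Sum>\<omega>'\<in>hat. rate \<omega> \<omega>' * (g \<omega>' - g \<omega>))"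

lemma generator_eq:
  assumes "(n, y) \<in> hat"
  shows "generator g (n, y) = \<sigma> * lap (\<lambda>y. g (n, y)) y
    + of_bool (n < int L) * (\<sigma> + b (n, y)) * (g (n + 1, y) - g (n, y))
    + of_bool (1 < n) * (\<sigma> - b (n, y)) * (g (n - 1, y) - g (n, y))"
  unfolding generator_def
  by (subst sum_rate_out[OF assms]) (simp add: laplacian_def algebra_simps)

lemma generator_harmonic_constant:
  assumes "\<And>\<omega>. \<omega> \<in> hat \<Longrightarrow> generator g \<omega> = 0"
  obtains c where "\<And>\<omega>. \<omega> \<in> hat \<Longrightarrow> g \<omega> = c"
  using harmonic_constant[of g] assms unfolding generator_def by blast

end

section \<open>Stationarity, in weak and pointwise form\<close>

locale stationary_walk = reflected_walk +
  fixes \<phi> assumes invariant: "invariant_density i1 L ell b \<phi>"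
begin

lemma density_pos: "\<omega> \<in> hat \<Longrightarrow> \<phi> \<omega> > 0"
  using invariant by (simp add: invariant_density_def)

lemma sum_density: "(\<Sum>\<omega>\<in>hat. \<phi> \<omega>) = real L * real (card T)"
proof -
  have "card hat > 0" using finite_hat hat_nonempty by (simp add: card_gt_0_iff)
  then have "(\<Sum>\<omega>\<in>hat. \<phi> \<omega>) = real (card hat)"
    using invariant by (simp add: invariant_density_def avg_def field_simps)
  then show ?thesis by (simp add: Omega_hat_def card_cartesian_product)
qed

lemma sum_density_generator: "(\<Sum>\<omega>\<in>hat. \<phi> \<omega> * generator g \<omega>) = 0"
proof -
  have "(\<Sum>\<omega>\<in>hat. \<phi> \<omega> * generator g \<omega>) =
      (\<Sum>\<omega>\<in>hat. \<Sum>\<omega>'\<in>hat. g \<omega>' * (\<phi> \<omega> * rate \<omega> \<omega>'))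
      - (\<Sum>\<omega>\<in>hat. g \<omega> * (\<phi> \<omega> * (\<Sum>\<omega>'\<in>hat. rate \<omega> \<omega>')))"
    by (simp add: generator_def sum_distrib_left algebra_simps sum_subtractf)
  also have "(\<Sum>\<omega>\<in>hat. \<Sum>\<omega>'\<in>hat. g \<omega>' * (\<phi> \<omega> * rate \<omega> \<omega>')) =
      (\<Sum>\<omega>'\<in>hat. g \<omega>' * (\<Sum>\<omega>\<in>hat. \<phi> \<omega> * rate \<omega> \<omega>'))"
    by (subst sum.swap) (simp add: sum_distrib_left)
  also have "\<dots> = (\<Sum>\<omega>'\<in>hat. g \<omega>' * (\<phi> \<omega>' * (\<Sum>\<omega>\<in>hat. rate \<omega>' \<omega>)))"
    using invariant by (simp add: invariant_density_def)
  finally show ?thesis by simp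
qed

text \<open>The master equation as transverse diffusion plus the net flux through the two bonds in
  direction \<open>i1\<close>; the bonds leaving \<open>hat\<close> carry no flux.\<close>

lemma fokker_planck:
  assumes "(n, y) \<in> hat"
  shows "\<sigma> * lap (\<lambda>y. \<phi> (n, y)) y
    + of_bool (1 < n) * ((\<sigma> + b (n - 1, y)) * \<phi> (n - 1, y) - (\<sigma> - b (n, y)) * \<phi> (n, y))
    + of_bool (n < int L) * ((\<sigma> - b (n + 1, y)) * \<phi> (n + 1, y) - (\<sigma> + b (n, y)) * \<phi> (n, y)) = 0"
proof -
  have "(\<Sum>\<omega>\<in>hat. \<phi> \<omega> * rate \<omega> (n, y)) = \<phi> (n, y) * (\<Sum>\<omega>\<in>hat. rate (n, y) \<omega> * 1)"
    using invariant assms by (simp add: invariant_density_def)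
  then show ?thesis
    unfolding sum_rate_in[OF assms] sum_rate_out[OF assms] lap_eq
    by (simp add: algebra_simps)
qed

lemma poisson_solvable:
  assumes "(\<Sum>\<omega>\<in>hat. \<phi> \<omega> * r \<omega>) = 0"
  obtains g where "\<And>\<omega>. \<omega> \<in> hat \<Longrightarrow> generator g \<omega> = r \<omega>"
  using fredholm[of \<phi> r] density_pos assms sum_density_generator unfolding generator_def by blast

end

section \<open>The harmonic coordinate\<close>

locale two_walks = stationary_walk i1 ell L b \<sigma> \<phi> +
    rev: stationary_walk i1 ell L "\<lambda>\<omega>. - b \<omega>" \<sigma> \<phi>\<^sub>R
  for i1 :: "'n::finite" and ell L b \<sigma> \<phi> \<phi>\<^sub>R
begin

text \<open>\<open>reflect\<close> folds \<open>\<int>\<close> onto \<open>{1..L}\<close> by the reflections in \<open>1/2\<close> and \<open>L + 1/2\<close>.\<close>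

definition wrap :: "int \<Rightarrow> int" where
  "wrap n = 1 + (n - 1) mod (2 * int L)"

definition reflect :: "int \<Rightarrow> int" where
  "reflect n = (if wrap n \<le> int L then wrap n else 2 * int L + 1 - wrap n)"

definition drift_at :: "int \<Rightarrow> int ^ 'n \<Rightarrow> real" where
  "drift_at n y = b (wrap n, y)"

definition rev_density :: "int \<Rightarrow> int ^ 'n \<Rightarrow> real" where
  "rev_density n y = \<phi>\<^sub>R (reflect n, y)"

lemma wrap_range: "1 \<le> wrap n" "wrap n \<le> 2 * int L"
  using L pos_mod_bound[of "2 * int L" "n - 1"] by (auto simp: wrap_def simp del: pos_mod_bound)

lemma wrap_id: "1 \<le> n \<Longrightarrow> n \<le> 2 * int L \<Longrightarrow> wrap n = n"
  by (simp add: wrap_def)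

lemma wrap_mult: "wrap (n + 2 * int L * k) = wrap n"
proof -
  have "n + 2 * int L * k - 1 = n - 1 + 2 * int L * k" by simp
  then show ?thesis unfolding wrap_def by (simp only: mod_mult_self2)
qed

lemma wrap_period: "wrap (n + 2 * int L) = wrap n"
  using wrap_mult[of n 1] by simp

lemma wrap_reflect: "wrap (1 - n) = 2 * int L + 1 - wrap n"
proof -
  define m where "m = 2 * int L"
  have "1 - n = (m + 1 - wrap n) + m * (- (1 + (n - 1) div m))"
    unfolding wrap_def m_def[symmetric] using div_mult_mod_eq[of "n - 1" m] by (simp add: algebra_simps)
  then have "wrap (1 - n) = wrap (m + 1 - wrap n)"
    by (simp only: m_def wrap_mult)
  also have "\<dots> = m + 1 - wrap n"
    using wrap_range[of n] by (intro wrap_id) (auto simp: m_def)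
  finally show ?thesis by (simp add: m_def)
qed

lemma reflect_reflect: "reflect (1 - n) = reflect n"
  unfolding reflect_def wrap_reflect using wrap_range[of n] by auto

lemma reflect_period: "reflect (n + 2 * int L) = reflect n"
  by (simp add: reflect_def wrap_period)

lemma reflect_id: "1 \<le> n \<Longrightarrow> n \<le> int L \<Longrightarrow> reflect n = n"
  by (simp add: reflect_def wrap_id)

lemma reflect_0: "reflect 0 = 1"
  using reflect_reflect[of 1] reflect_id[of 1] L by simp

lemma reflect_Suc_L: "reflect (int L + 1) = int L"
proof -
  have "reflect (int L + 1) = reflect (1 - int L + 2 * int L)" by (simp add: algebra_simps)
  then show ?thesis
    unfolding reflect_period reflect_reflect using L by (simp add: reflect_id)
qed

lemma drift_at_period: "drift_at (n + 2 * int L) y = drift_at n y"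
  by (simp add: drift_at_def wrap_period)

lemma drift_at_reflect: "y \<in> T \<Longrightarrow> drift_at (1 - n) y = - drift_at n y"
  unfolding drift_at_def wrap_reflect using wrap_range by (intro odd_drift) auto

lemma drift_at_hat: "1 \<le> n \<Longrightarrow> n \<le> 2 * int L \<Longrightarrow> drift_at n y = b (n, y)"
  by (simp add: drift_at_def wrap_id)

lemma drift_at_0: "y \<in> T \<Longrightarrow> drift_at 0 y = - b (1, y)"
  using drift_at_reflect[of y 1] L by (simp add: drift_at_hat)

lemma drift_at_Suc_L: "y \<in> T \<Longrightarrow> drift_at (int L + 1) y = - b (int L, y)"
proof -
  assume y: "y \<in> T"
  have "drift_at (int L + 1) y = drift_at (1 - int L + 2 * int L) y" by (simp add: algebra_simps)
  then show ?thesis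
    unfolding drift_at_period drift_at_reflect[OF y] using L by (simp add: drift_at_hat)
qed

lemma all_periods:
  assumes "\<And>n. Q n \<Longrightarrow> Q (n + 2 * int L)" "\<And>n. Q n \<Longrightarrow> Q (n - 2 * int L)" "Q (wrap n)"
  shows "Q n"
proof -
  have "Q (wrap n + 2 * int L * m)" for m
  proof (induction m rule: int_induct[where k = 0])
    case (step1 m)
    from assms(1)[OF step1(2)] show ?case by (simp add: algebra_simps)
  next
    case (step2 m)
    from assms(2)[OF step2(2)] show ?case by (simp add: algebra_simps)
  qed (use assms(3) in simp)
  from this[of "(n - 1) div (2 * int L)"] show ?thesis
    unfolding wrap_def using mod_mult_div_eq[of "n - 1" "2 * int L"] by (simp add: algebra_simps)
qed

text \<open>{1..L} is a fundamental domain for the group generated by the reflection in 1/2 and the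
  translation by 2L.\<close>

lemma all_reflections:
  assumes base: "\<And>n. 1 \<le> n \<Longrightarrow> n \<le> int L \<Longrightarrow> Q n"
    and reflect: "\<And>n. Q n \<Longrightarrow> Q (1 - n)"
    and period: "\<And>n. Q n \<Longrightarrow> Q (n + 2 * int L)" "\<And>n. Q n \<Longrightarrow> Q (n - 2 * int L)"
  shows "Q n"
proof (rule all_periods[of Q, OF period])
  show "Q (wrap n)"
  proof (cases "wrap n \<le> int L")
    case True
    with base[of "wrap n"] wrap_range show ?thesis by simp
  next
    case False
    with base[of "2 * int L + 1 - wrap n"] wrap_range have "Q (2 * int L + 1 - wrap n)" by simp
    from period(1)[OF reflect[OF this]] show ?thesis by (simp add: algebra_simps)
  qed
qed

lemma rev_density_period: "rev_density (n + 2 * int L) y = rev_density n y"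
  by (simp add: rev_density_def reflect_period)

lemma rev_density_reflect: "rev_density (1 - n) y = rev_density n y"
  by (simp add: rev_density_def reflect_reflect)

lemma rev_density_hat: "1 \<le> n \<Longrightarrow> n \<le> int L \<Longrightarrow> rev_density n y = \<phi>\<^sub>R (n, y)"
  by (simp add: rev_density_def reflect_id)

text \<open>Even extension of the density together with odd extension of the drift turns the
  reflecting boundary into an ordinary bond, so the stationary equation for drift -b holds on all of
  the integers.\<close>

lemma rev_fokker_planck:
  assumes y: "y \<in> T"
  shows "\<sigma> * (rev_density (n + 1) y + rev_density (n - 1) y - 2 * rev_density n y + lap (rev_density n) y)
      + drift_at (n + 1) y * rev_density (n + 1) y - drift_at (n - 1) y * rev_density (n - 1) y = 0"
    (is "?Q n = 0")
proof (rule all_reflections[of "\<lambda>n. ?Q n = 0"])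
  fix n assume n: "1 \<le> n" "n \<le> int L"
  then have hat: "(n, y) \<in> hat" by (simp add: in_hat y)
  \<comment> \<open>Flow from 0 to 1 balances flow from 1 to 0, so adding the bond changes nothing;
    \<open>upper\<close> is the same at the bond between L and L + 1.\<close>
  have lower: "(\<sigma> - drift_at (n - 1) y) * rev_density (n - 1) y = (\<sigma> + b (n, y)) * \<phi>\<^sub>R (n, y)"
    if "\<not> 1 < n"
  proof -
    have "n = 1" using that n by simp
    then show ?thesis using drift_at_0[OF y] L by (simp add: rev_density_def reflect_0)
  qed
  have lower': "drift_at (n - 1) y = b (n - 1, y)" "rev_density (n - 1) y = \<phi>\<^sub>R (n - 1, y)" if "1 < n"
    using that n by (simp_all add: drift_at_hat rev_density_hat)
  have upper: "(\<sigma> + drift_at (n + 1) y) * rev_density (n + 1) y = (\<sigma> - b (n, y)) * \<phi>\<^sub>R (n, y)"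
    if "\<not> n < int L"
  proof -
    have "n = int L" using that n by simp
    then show ?thesis using drift_at_Suc_L[OF y] by (simp add: rev_density_def reflect_Suc_L)
  qed
  have upper': "drift_at (n + 1) y = b (n + 1, y)" "rev_density (n + 1) y = \<phi>\<^sub>R (n + 1, y)" if "n < int L"
    using that n by (simp_all add: drift_at_hat rev_density_hat)
  define l where "l = \<sigma> * lap (\<lambda>y. \<phi>\<^sub>R (n, y)) y"
  have "rev_density n = (\<lambda>y. \<phi>\<^sub>R (n, y))" using n by (auto simp: rev_density_hat)
  then have split: "\<sigma> * (a + lap (rev_density n) y) = \<sigma> * a + l" for a
    by (simp add: l_def distrib_left)
  show "?Q n = 0"
    unfolding split using rev.fokker_planck[OF hat, folded l_def] lower lower' upper upper' rev_density_hat[OF n, of y]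
    by (cases "1 < n"; cases "n < int L") (simp_all add: algebra_simps)
next
  have lap: "rev_density (1 - n) = rev_density n" for n by (auto simp: rev_density_reflect)
  have *: "1 - n + 1 = 1 - (n - 1)" "1 - n - 1 = 1 - (n + 1)" for n :: int by simp_all
  have "?Q (1 - n) = ?Q n" for n
    unfolding * lap drift_at_reflect[OF y] by (simp add: algebra_simps)
  then show "?Q (1 - n) = 0" if "?Q n = 0" for n
    using that by simp
next
  have lap: "rev_density (n + 2 * int L) = rev_density n" for n by (auto simp: rev_density_period)
  have *: "n + 2 * int L + 1 = (n + 1) + 2 * int L" "n + 2 * int L - 1 = (n - 1) + 2 * int L" for n
    by simp_all
  have period: "?Q (n + 2 * int L) = ?Q n" for n
    unfolding * lap drift_at_period ..
  show "?Q (n + 2 * int L) = 0" if "?Q n = 0" for n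
    using that unfolding period .
  show "?Q (n - 2 * int L) = 0" if "?Q n = 0" for n
    using that period[of "n - 2 * int L"] by simp
qed

text \<open>The first row X(1), forced by harmonicity at n = 1. Oddness gives X(0) = -X(1), and the
  recursion gives X(2) = -X(1) + 2 \<open>\<phi>\<^sub>R\<close> (1, .). Hence X(2) + X(0) - 2 X(1)
  contains -4 X(1), the source of the 4 in the resolvent, and the terms in
  \<open>\<phi>\<^sub>R\<close> add up to twice \<open>psi\<close> for -b.\<close>

definition coord1 :: "int ^ 'n \<Rightarrow> real" where
  "coord1 y = 2 / \<sigma> * inv_neg_laplacian_plus_4 i1 ell (psi (\<lambda>\<omega>. - b \<omega>) \<phi>\<^sub>R) y"

lemma coord1: "y \<in> T \<Longrightarrow> 4 * coord1 y - lap coord1 y = 2 / \<sigma> * (\<sigma> + b (1, y)) * \<phi>\<^sub>R (1, y)"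
  using inv_neg_laplacian_plus_4[of y "psi (\<lambda>\<omega>. - b \<omega>) \<phi>\<^sub>R"]
  unfolding coord1_def[abs_def] lap_scale by (simp add: psi_def \<sigma> algebra_simps)

fun coord_nat :: "nat \<Rightarrow> int ^ 'n \<Rightarrow> real" where
  "coord_nat 0 = (\<lambda>y. - coord1 y)"
| "coord_nat (Suc 0) = coord1"
| "coord_nat (Suc (Suc m)) = (\<lambda>y. coord_nat m y + 2 * rev_density (int (Suc m)) y)"

text \<open>
  The harmonic coordinate \<open>X\<close>, centred so that it is odd under the reflection in \<open>1/2\<close>.  Differencing the
  harmonicity equation shows that \<open>X (n + 1) - X (n - 1)\<close> satisfies the stationary equation of the walk
  with drift \<open>-b\<close>, whence the recursion.
\<close>

definition coord :: "int \<Rightarrow> int ^ 'n \<Rightarrow> real" where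
  "coord n y = (if n \<ge> 0 then coord_nat (nat n) y else - coord_nat (nat (1 - n)) y)"

lemma coord_0: "coord 0 y = - coord1 y" and coord_1: "coord 1 y = coord1 y"
  by (simp_all add: coord_def)

lemma coord_reflect: "coord (1 - n) y = - coord n y"
proof -
  consider "n < 0" | "n = 0" | "n = 1" | "n > 1" by linarith
  then show ?thesis by cases (auto simp: coord_def)
qed

lemma coord_step: "coord (n + 1) y = coord (n - 1) y + 2 * rev_density n y"
proof -
  have pos: "coord (n + 1) y = coord (n - 1) y + 2 * rev_density n y" if "n \<ge> 1" for n
  proof -
    define m where "m = nat (n - 1)"
    have "n = int (Suc m)" using that by (simp add: m_def)
    then show ?thesis by (simp add: coord_def nat_add_distrib)
  qed
  show ?thesis
  proof (cases "n \<ge> 1")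
    case False
    then have "coord (1 - n + 1) y = coord (1 - n - 1) y + 2 * rev_density (1 - n) y"
      by (intro pos) simp
    moreover have "coord (1 - n + 1) y = - coord (n - 1) y" "coord (1 - n - 1) y = - coord (n + 1) y"
      using coord_reflect[of "n - 1" y] coord_reflect[of "n + 1" y] by (simp_all add: algebra_simps)
    ultimately show ?thesis by (simp add: rev_density_reflect)
  qed (rule pos)
qed

text \<open>The recursion for X has step two and does not see the other parity class, so each class
  needs its own base case.\<close>

lemma parity_induct:
  assumes "P 0" "P 1" and step: "\<And>n. P (n - 1) \<longleftrightarrow> P (n + 1)"
  shows "P (n :: int)"
proof -
  have "P n \<and> P (n + 1)"
  proof (induction n rule: int_induct[where k = 0])
    case (step1 n)
    with step[of "n + 1"] show ?case by (simp add: add.commute add.left_commute)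
  next
    case (step2 n)
    with step[of n] show ?case by simp
  qed (use assms in simp)
  then show ?thesis by blast
qed

text \<open>Harmonicity of X, with X(n+1) - X(n-1) already replaced by twice the density. The left
  sides at n + 1 and n - 1 differ by twice that of \<open>rev_fokker_planck\<close> at n, so rows 0
  and 1 decide. Row 1 is the choice of \<open>coord1\<close>; row 0 follows from it by
  oddness.\<close>

lemma coord_equation:
  assumes y: "y \<in> T"
  shows "\<sigma> * (coord (n + 1) y + coord (n - 1) y - 2 * coord n y + lap (coord n) y)
      + 2 * drift_at n y * rev_density n y = 0"
    (is "?E n = 0")
proof -
  have step: "?E (n + 1) = ?E (n - 1)" for n
  proof -
    have "coord (n + 1) = (\<lambda>y. coord (n - 1) y + 2 * rev_density n y)"
      by (auto simp: coord_step)
    then have lap: "lap (coord (n + 1)) y = lap (coord (n - 1)) y + 2 * lap (rev_density n) y"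
      by (simp only: lap_add lap_scale)
    show ?thesis
      unfolding lap using coord_step[of "n + 1" y] coord_step[of n y] coord_step[of "n - 1" y]
        rev_fokker_planck[OF y, of n] by (simp add: algebra_simps)
  qed
  have coord: "coord 1 = coord1" by (auto simp: coord_1)
  have 1: "?E 1 = 0"
  proof -
    have c2: "coord 2 y = 2 * \<phi>\<^sub>R (1, y) - coord1 y"
      using coord_step[of 1 y] L by (simp add: coord_0 rev_density_hat)
    have "\<sigma> * (4 * coord1 y - lap coord1 y) = 2 * (\<sigma> + b (1, y)) * \<phi>\<^sub>R (1, y)"
      using coord1[OF y] \<sigma>_pos by simp
    then show ?thesis
      using L by (simp add: c2 coord coord_0 rev_density_hat drift_at_hat algebra_simps)
  qed
  have "coord 0 = (\<lambda>y. - coord 1 y)" by (auto simp: coord_0 coord_1)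
  then have lap: "lap (coord 0) y = - lap (coord 1) y" by (simp only: lap_uminus)
  have refl: "coord (- 1) y = - coord 2 y" "rev_density 0 y = rev_density 1 y" "drift_at 0 y = - drift_at 1 y"
    using coord_reflect[of 2 y] rev_density_reflect[of 1 y] drift_at_reflect[OF y, of 1] by simp_all
  have 0: "?E 0 = 0"
    using 1 unfolding lap by (simp add: refl coord coord_0 algebra_simps)
  show ?thesis
    by (rule parity_induct[of "\<lambda>n. ?E n = 0"]) (use 0 1 step in \<open>simp_all only:\<close>)
qed

text \<open>The increment over a period is unchanged by steps of two because the density is
  periodic; the reflection \<open>refl\<close> sends n to 1 - n - 2L and so links the two
  parities.\<close>

lemma coord_period_const: 
  "coord (n + 2 * int L) y - coord n y = coord (2 * int L) y - coord 0 y"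
proof -
  define D where "D n = coord (n + 2 * int L) y - coord n y" for n
  have step: "D (n + 1) = D (n - 1)" for n
    using coord_step[of "n + 2 * int L" y, unfolded rev_density_period] coord_step[of n y]
    by (simp add: D_def algebra_simps)
  have refl: "D (1 - n - 2 * int L) = D n" for n
    using coord_reflect[of n y] coord_reflect[of "n + 2 * int L" y]
    by (simp add: D_def algebra_simps)
  have even: "D (n + 2 * m) = D n" for n m
  proof (induction m rule: int_induct[where k = 0])
    case (step1 m)
    with step[of "n + 2 * m + 1"] show ?case by (simp add: algebra_simps)
  next
    case (step2 m)
    with step[of "n + 2 * m - 1"] show ?case by (simp add: algebra_simps)
  qed simp
  have "D n = D 0"
  proof (rule parity_induct[of "\<lambda>n. D n = D 0"])
    show "D 1 = D 0" using refl[of 0] even[of 1 "- int L"] by simp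
    show "D (n - 1) = D 0 \<longleftrightarrow> D (n + 1) = D 0" for n by (simp only: step)
  qed simp
  then show ?thesis by (simp add: D_def)
qed

text \<open>X has mean slope exactly 1: the increment over a period is harmonic in y, hence
  constant, and the normalization of \<open>\<phi>\<^sub>R\<close> fixes the constant.\<close>

lemma coord_period:
  assumes y: "y \<in> T"
  shows "coord (n + 2 * int L) y = coord n y + 2 * real L"
proof -
  define D where "D y = coord (2 * int L) y - coord 0 y" for y
  have D: "coord (n + 2 * int L) y = coord n y + D y" for n y
    using coord_period_const[of n y] by (simp add: D_def)
  have "lap D y = 0" if "y \<in> T" for y
  proof -
    have coord: "coord (0 + 2 * int L) = (\<lambda>y. coord 0 y + D y)" by (auto simp only: D)
    have "lap (coord (0 + 2 * int L)) y = lap (coord 0) y + lap D y"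
      unfolding coord lap_add ..
    moreover have "0 + 2 * int L + 1 = 1 + 2 * int L" "0 + 2 * int L - 1 = - 1 + 2 * int L" by simp_all
    ultimately have "\<sigma> * lap D y = 0"
      using coord_equation[OF that, of "0 + 2 * int L"] coord_equation[OF that, of 0]
      unfolding drift_at_period rev_density_period
      by (simp only: D) (simp add: algebra_simps)
    then show ?thesis using \<sigma>_pos by simp
  qed
  \<comment> \<open>Read as a function on \<open>hat\<close> that does not depend on n,
    \<open>D\<close> falls under the maximum principle for the walk.\<close>
  then have "generator (\<lambda>(n, y). D y) \<omega> = 0" if "\<omega> \<in> hat" for \<omega>
    using that by (cases \<omega>) (auto simp: generator_eq in_hat)
  then obtain c where "\<And>\<omega>. \<omega> \<in> hat \<Longrightarrow> (\<lambda>(n, y). D y) \<omega> = c"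
    using generator_harmonic_constant[of "\<lambda>(n, y). D y"] by blast
  then have c: "D y = c" if "y \<in> T" for y
    using that L by (force simp: in_hat)
  have D_sum: "D y = 2 * (\<Sum>n=1..int L. \<phi>\<^sub>R (n, y))" for y
  proof -
    \<comment> \<open>Telescoping with step two leaves two rows at each end. Rows 0 and 1 cancel by
      oddness; for m = L the upper rows add up to \<open>D y\<close>.\<close>
    have tele: "(\<Sum>n=1..int m. rev_density n y) * 2 = coord (int m + 1) y + coord (int m) y - coord 1 y - coord 0 y" for m
    proof (induction m)
      case (Suc m)
      have "{1..int (Suc m)} = insert (int m + 1) {1..int m}" by auto
      with Suc coord_step[of "int m + 1" y] show ?case by (simp add: algebra_simps)
    qed simp
    have refl: "coord (1 + int L) y = D y - coord (int L) y"
      using coord_reflect[of "int L" y] D[of "1 - int L" y] by (simp add: algebra_simps)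
    have "(\<Sum>n=1..int L. rev_density n y) * 2 = D y"
      unfolding tele using refl by (simp add: coord_0 coord_1 add.commute)
    then show ?thesis by (simp add: rev_density_hat mult.commute)
  qed
  have "real (card T) * c = (\<Sum>y\<in>T. D y)" using c by simp
  also have "\<dots> = 2 * (\<Sum>y\<in>T. \<Sum>n=1..int L. \<phi>\<^sub>R (n, y))"
    unfolding D_sum sum_distrib_left ..
  also have "(\<Sum>y\<in>T. \<Sum>n=1..int L. \<phi>\<^sub>R (n, y)) = (\<Sum>\<omega>\<in>hat. \<phi>\<^sub>R \<omega>)"
    unfolding Omega_hat_def by (subst sum.swap, subst sum.cartesian_product) simp
  also have "\<dots> = real L * real (card T)" by (rule rev.sum_density)
  finally have "c = 2 * real L" using finite_torus y by auto
  with D c[OF y] show ?thesis by simp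
qed

lemma coord_Suc_L: "y \<in> T \<Longrightarrow> coord (int L + 1) y = 2 * real L - coord (int L) y"
  using coord_period[of y "1 - int L"] coord_reflect[of "int L" y] by (simp add: algebra_simps)

end

section \<open>The effective diffusivity and the corrector\<close>

context reflected_walk
begin

text \<open>The environment seen from the base point \<open>(2 L, 0)\<close>, i.e. from \<open>n = 0\<close>.\<close>

definition lattice_drift :: "int ^ 'n \<Rightarrow> real" where
  "lattice_drift k = b (translate i1 L ell k (2 * int L, 0))"

definition lattice_generator :: "(int ^ 'n \<Rightarrow> real) \<Rightarrow> int ^ 'n \<Rightarrow> real" where
  "lattice_generator g k = \<sigma> * (\<Sum>i\<in>UNIV. g (k + axis i 1) + g (k - axis i 1) - 2 * g k)
     + lattice_drift k * (g (k + axis i1 1) - g (k - axis i1 1))"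

lemma translate_in_Omega: "translate i1 L ell k \<omega> \<in> Omega i1 L ell"
proof (cases \<omega>)
  case (Pair n y)
  have "1 + (n + k $ i1 - 1) mod (2 * int L) \<le> 2 * int L"
    using L pos_mod_bound[of "2 * int L" "n + k $ i1 - 1"] by linarith
  then show ?thesis using L shift_in_torus by (auto simp: Pair translate_def Omega_def)
qed

lemma lattice_drift_bound: "\<bar>lattice_drift k\<bar> < \<sigma>"
  unfolding lattice_drift_def by (intro drift translate_in_Omega)

lemma lattice_generator_diff:
  "lattice_generator (\<lambda>k. f k - g k) k = lattice_generator f k - lattice_generator g k"
  by (simp add: lattice_generator_def sum_subtractf sum.distrib algebra_simps)

lemma lattice_generator_add:
  "lattice_generator (\<lambda>k. f k + g k) k = lattice_generator f k + lattice_generator g k"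
  by (simp add: lattice_generator_def sum_subtractf sum.distrib algebra_simps)

lemma lattice_generator_scale:
  "lattice_generator (\<lambda>k. c * g k) k = c * lattice_generator g k"
  by (simp add: lattice_generator_def sum_distrib_left algebra_simps)

text \<open>Written with rates \<sigma> + b and \<sigma> - b, which the drift bound makes
  nonnegative, the generator is a nonnegative combination of increments.\<close>

lemma lattice_generator_nonneg_at_min:
  assumes min: "\<And>i. g k \<le> g (k + axis i 1)" "\<And>i. g k \<le> g (k - axis i 1)"
  shows "lattice_generator g k \<ge> 0"
proof -
  have "(\<Sum>i\<in>UNIV. g (k + axis i 1) + g (k - axis i 1) - 2 * g k)
      = (g (k + axis i1 1) + g (k - axis i1 1) - 2 * g k)
        + (\<Sum>i\<in>UNIV - {i1}. g (k + axis i 1) + g (k - axis i 1) - 2 * g k)"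
    by (rule sum.remove) auto
  then have "lattice_generator g k = (\<sigma> + lattice_drift k) * (g (k + axis i1 1) - g k)
      + (\<sigma> - lattice_drift k) * (g (k - axis i1 1) - g k)
      + \<sigma> * (\<Sum>i\<in>UNIV - {i1}. g (k + axis i 1) + g (k - axis i 1) - 2 * g k)"
    unfolding lattice_generator_def by (simp only:) (simp add: algebra_simps)
  also have "\<dots> \<ge> 0"
  proof -
    have rates: "0 \<le> \<sigma> + lattice_drift k" "0 \<le> \<sigma> - lattice_drift k"
      using lattice_drift_bound[of k] by auto
    have "0 \<le> (\<Sum>i\<in>UNIV - {i1}. g (k + axis i 1) + g (k - axis i 1) - 2 * g k)"
    proof (rule sum_nonneg)
      show "0 \<le> g (k + axis i 1) + g (k - axis i 1) - 2 * g k" for i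
        using min[of i] by linarith
    qed
    then have "0 \<le> \<sigma> * (\<Sum>i\<in>UNIV - {i1}. g (k + axis i 1) + g (k - axis i 1) - 2 * g k)"
      using \<sigma>_pos by simp
    moreover have "0 \<le> (\<sigma> + lattice_drift k) * (g (k + axis i1 1) - g k)"
      "0 \<le> (\<sigma> - lattice_drift k) * (g (k - axis i1 1) - g k)"
      using rates min[of i1] by simp_all
    ultimately show ?thesis by linarith
  qed
  finally show ?thesis .
qed

lemma lattice_generator_squares:
  "lattice_generator (\<lambda>k. \<Sum>j\<in>UNIV - {i1}. (real_of_int (k $ j))\<^sup>2) k = 2 * \<sigma> * real (CARD('n) - 1)"
proof -
  let ?q = "\<lambda>k :: int ^ 'n. \<Sum>j\<in>UNIV - {i1}. (real_of_int (k $ j))\<^sup>2"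
  have diff: "?q (k + axis i 1) + ?q (k - axis i 1) - 2 * ?q k = of_bool (i \<noteq> i1) * 2" for i
  proof -
    have "?q (k + axis i 1) + ?q (k - axis i 1) - 2 * ?q k = (\<Sum>j\<in>UNIV - {i1}. if j = i then 2 else 0)"
      unfolding sum_distrib_left sum.distrib[symmetric] sum_subtractf[symmetric]
      by (intro sum.cong refl) (simp add: axis_def power2_eq_square algebra_simps)
    then show ?thesis by simp
  qed
  have "?q (k + axis i1 1) = ?q k" "?q (k - axis i1 1) = ?q k"
    by (auto intro!: sum.cong simp: axis_def)
  moreover have "(\<Sum>i\<in>UNIV. of_bool (i \<noteq> i1) * 2) = 2 * real (CARD('n) - 1)"
    by (subst sum.remove[of UNIV i1]) simp_all
  ultimately show ?thesis
    unfolding lattice_generator_def diff by simp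
qed

end

section \<open>Green's identity on the half period and the corrector of X^2\<close>

context two_walks
begin

text \<open>The walk without reflection, on the integers times the torus, in the extended
  drift.\<close>

definition full_generator :: "(int \<Rightarrow> int ^ 'n \<Rightarrow> real) \<Rightarrow> int \<Rightarrow> int ^ 'n \<Rightarrow> real" where
  "full_generator g n y = \<sigma> * lap (g n) y + (\<sigma> + drift_at n y) * (g (n + 1) y - g n y)
     + (\<sigma> - drift_at n y) * (g (n - 1) y - g n y)"

definition coord_sq :: "int \<Rightarrow> int ^ 'n \<Rightarrow> real" where
  "coord_sq n y = (coord n y)\<^sup>2"

definition diffusivity :: real where
  "diffusivity = 2 * avg T (\<lambda>y. psi b \<phi> y * coord1 y)"

lemma full_generator_add:
  "full_generator (\<lambda>n y. f n y + g n y) n y = full_generator f n y + full_generator g n y"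
  by (simp add: full_generator_def lap_add algebra_simps)

lemma full_generator_scale: "full_generator (\<lambda>n y. c * f n y) n y = c * full_generator f n y"
  by (simp add: full_generator_def lap_scale algebra_simps)

lemma full_generator_const: "full_generator (\<lambda>_ _. c) n y = 0"
  by (simp add: full_generator_def lap_const)

lemma full_generator_cong:
  assumes "\<And>n y. y \<in> T \<Longrightarrow> f n y = g n y" "y \<in> T"
  shows "full_generator f n y = full_generator g n y"
  using assms lap_cong[of "f n" "g n" y] by (simp add: full_generator_def)

lemma full_generator_shift:
  "full_generator (\<lambda>n. g (n + 2 * int L)) n y = full_generator g (n + 2 * int L) y"
proof -
  have "n + 2 * int L + 1 = n + 1 + 2 * int L" "n + 2 * int L - 1 = n - 1 + 2 * int L" by simp_all
  then show ?thesis by (simp only: full_generator_def drift_at_period)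
qed

lemma full_generator_reflect:
  assumes even: "\<And>n y. g (1 - n) y = g n y" and y: "y \<in> T"
  shows "full_generator g (1 - n) y = full_generator g n y"
proof -
  have "g (1 - n) = g n" for n using even by auto
  moreover have "1 - n + 1 = 1 - (n - 1)" "1 - n - 1 = 1 - (n + 1)" by simp_all
  ultimately show ?thesis
    by (simp only: full_generator_def drift_at_reflect[OF y]) simp
qed

lemma full_generator_coord: "y \<in> T \<Longrightarrow> full_generator coord n y = 0"
  using coord_equation[of y n] coord_step[of n y] by (simp add: full_generator_def algebra_simps)

text \<open>(X + 2L)^2 = X^2 + 4L X + 4L^2, and the generator annihilates X and constants.\<close>

lemma full_generator_coord_sq_period:
  assumes y: "y \<in> T"
  shows "full_generator coord_sq (n + 2 * int L) y = full_generator coord_sq n y"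
proof -
  have "full_generator coord_sq (n + 2 * int L) y = full_generator (\<lambda>n y. coord_sq (n + 2 * int L) y) n y"
    by (simp only: full_generator_shift)
  also have "\<dots> = full_generator (\<lambda>n y. coord_sq n y + (4 * real L * coord n y + 4 * (real L)\<^sup>2)) n y"
  proof (rule full_generator_cong[OF _ y])
    fix n y assume "y \<in> T"
    from coord_period[OF this, of n]
    show "coord_sq (n + 2 * int L) y = coord_sq n y + (4 * real L * coord n y + 4 * (real L)\<^sup>2)"
      unfolding coord_sq_def by (simp only:) (simp add: power2_eq_square algebra_simps)
  qed
  also have "\<dots> = full_generator coord_sq n y"
    by (simp only: full_generator_add full_generator_scale full_generator_const full_generator_coord[OF y] mult_zero_right add_0_right)
  finally show ?thesis .
qed

lemma psi_eq: "psi b \<phi> y = (\<sigma> - b (1, y)) * \<phi> (1, y)"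
  by (simp add: psi_def \<sigma>)

lemma full_generator_eq_generator:
  assumes "(n, y) \<in> hat"
  shows "full_generator g n y = generator (\<lambda>(n, y). g n y) (n, y)
    + of_bool (n = int L) * ((\<sigma> + b (int L, y)) * (g (int L + 1) y - g (int L) y))
    + of_bool (n = 1) * ((\<sigma> - b (1, y)) * (g 0 y - g 1 y))"
  using assms by (auto simp: full_generator_def generator_eq[OF assms] drift_at_hat in_hat)

lemma sum_hat_row:
  assumes "1 \<le> m" "m \<le> int L"
  shows "(\<Sum>(n, y)\<in>hat. of_bool (n = m) * h y) = (\<Sum>y\<in>T. h y :: real)"
proof -
  have "(\<Sum>(n, y)\<in>hat. of_bool (n = m) * h y) = (\<Sum>n=1..int L. of_bool (n = m) * (\<Sum>y\<in>T. h y))"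
    unfolding Omega_hat_def by (simp add: sum_distrib_left flip: sum.cartesian_product)
  also have "\<dots> = (\<Sum>y\<in>T. h y)"
    using assms by (simp add: of_bool_def if_distrib[of "\<lambda>t. t * _"] cong: if_cong)
  finally show ?thesis .
qed

text \<open>Green's identity: \<open>\<phi>\<close> annihilates the reflected generator, so only the
  bonds between L and L + 1 and between 0 and 1 contribute.\<close>

lemma sum_density_full_generator:
  "(\<Sum>(n, y)\<in>hat. \<phi> (n, y) * full_generator g n y) =
     (\<Sum>y\<in>T. \<phi> (int L, y) * (\<sigma> + b (int L, y)) * (g (int L + 1) y - g (int L) y))
     + (\<Sum>y\<in>T. psi b \<phi> y * (g 0 y - g 1 y))"
proof -
  have "(\<Sum>(n, y)\<in>hat. \<phi> (n, y) * full_generator g n y) =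
      (\<Sum>(n, y)\<in>hat. \<phi> (n, y) * generator (\<lambda>(n, y). g n y) (n, y)
       + of_bool (n = int L) * (\<phi> (int L, y) * (\<sigma> + b (int L, y)) * (g (int L + 1) y - g (int L) y))
       + of_bool (n = 1) * (psi b \<phi> y * (g 0 y - g 1 y)))"
    by (intro sum.cong refl)
      (auto simp: full_generator_eq_generator psi_eq algebra_simps)
  also have "\<dots> = (\<Sum>\<omega>\<in>hat. \<phi> \<omega> * generator (\<lambda>(n, y). g n y) \<omega>)
      + (\<Sum>(n, y)\<in>hat. of_bool (n = int L) * (\<phi> (int L, y) * (\<sigma> + b (int L, y)) * (g (int L + 1) y - g (int L) y)))
      + (\<Sum>(n, y)\<in>hat. of_bool (n = 1) * (psi b \<phi> y * (g 0 y - g 1 y)))"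
    by (simp only: sum.distrib split_def prod.collapse)
  finally show ?thesis
    using L by (simp add: sum_density_generator sum_hat_row)
qed

text \<open>Taking X in Green's identity expresses the flux at L through \<open>psi\<close> and
  X(1). Taking X^2, the bond between 0 and 1 drops out because X(0)^2 = X(1)^2, and the other term
  is 2L times that flux because X(L+1) + X(L) = 2L.\<close>

lemma mean_coord_sq:
  "(\<Sum>(n, y)\<in>hat. \<phi> (n, y) * full_generator coord_sq n y) = 4 * real L * (\<Sum>y\<in>T. psi b \<phi> y * coord1 y)"
proof -
  let ?f = "\<lambda>y. \<phi> (int L, y) * (\<sigma> + b (int L, y))"
  have "(\<Sum>(n, y)\<in>hat. \<phi> (n, y) * full_generator coord n y) = 0"
    by (intro sum.neutral) (auto simp: full_generator_coord in_hat)
  then have flux: "(\<Sum>y\<in>T. ?f y * (coord (int L + 1) y - coord (int L) y)) = 2 * (\<Sum>y\<in>T. psi b \<phi> y * coord1 y)"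
    unfolding sum_density_full_generator
    by (simp add: coord_0 coord_1 sum_negf sum_distrib_left algebra_simps)
  have "(\<Sum>y\<in>T. ?f y * (coord_sq (int L + 1) y - coord_sq (int L) y))
      = (\<Sum>y\<in>T. 2 * real L * (?f y * (coord (int L + 1) y - coord (int L) y)))"
  proof (intro sum.cong refl)
    fix y assume "y \<in> T"
    from coord_Suc_L[OF this]
    have "coord_sq (int L + 1) y - coord_sq (int L) y = 2 * real L * (coord (int L + 1) y - coord (int L) y)"
      unfolding coord_sq_def by (simp only:) (simp add: power2_eq_square algebra_simps)
    then show "?f y * (coord_sq (int L + 1) y - coord_sq (int L) y)
        = 2 * real L * (?f y * (coord (int L + 1) y - coord (int L) y))"
      by (simp only: mult_ac)
  qed
  then show ?thesis
    unfolding sum_density_full_generator sum_distrib_left[symmetric] flux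
    by (simp add: coord_sq_def coord_0 coord_1)
qed

text \<open>\<open>diffusivity\<close> is exactly the constant for which the solvability condition
  of the Poisson equation holds. The corrector is solved for on \<open>hat\<close> and unfolded
  evenly.\<close>

lemma profile_exists:
  obtains \<theta> where "\<And>n y. y \<in> T \<Longrightarrow>
      full_generator (\<lambda>n y. coord_sq n y + \<theta> (reflect n, y)) n y = 2 * diffusivity"
proof -
  have card: "real (card T) > 0" using finite_torus zero_in_torus by (auto simp: card_gt_0_iff)
  have "(\<Sum>(n, y)\<in>hat. \<phi> (n, y) * (2 * diffusivity - full_generator coord_sq n y))
      = 2 * diffusivity * (\<Sum>\<omega>\<in>hat. \<phi> \<omega>) - (\<Sum>(n, y)\<in>hat. \<phi> (n, y) * full_generator coord_sq n y)"
    by (simp add: split_def right_diff_distrib sum_subtractf flip: sum_distrib_right)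
  also have "\<dots> = 0"
    unfolding sum_density mean_coord_sq using card by (simp add: diffusivity_def avg_def)
  finally have "(\<Sum>\<omega>\<in>hat. \<phi> \<omega> * (2 * diffusivity - full_generator coord_sq (fst \<omega>) (snd \<omega>))) = 0"
    by (simp add: split_def)
  then obtain \<theta> where \<theta>: "\<And>\<omega>. \<omega> \<in> hat \<Longrightarrow>
      generator \<theta> \<omega> = 2 * diffusivity - full_generator coord_sq (fst \<omega>) (snd \<omega>)"
    using poisson_solvable[of "\<lambda>\<omega>. 2 * diffusivity - full_generator coord_sq (fst \<omega>) (snd \<omega>)"] by blast
  define \<Theta> where "\<Theta> n y = \<theta> (reflect n, y)" for n y
  have "full_generator coord_sq n y + full_generator \<Theta> n y = 2 * diffusivity" if y: "y \<in> T" for n y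
  proof (rule all_reflections[of "\<lambda>n. full_generator coord_sq n y + full_generator \<Theta> n y = 2 * diffusivity"])
    fix n assume n: "1 \<le> n" "n \<le> int L"
    then have hat: "(n, y) \<in> hat" using y by (simp add: in_hat)
    have "generator (\<lambda>(n, y). \<Theta> n y) (n, y) = generator \<theta> (n, y)"
      unfolding generator_def using n
      by (intro sum.cong refl) (auto simp: \<Theta>_def reflect_id in_hat)
    \<comment> \<open>The even extension has equal values on both sides of each boundary bond, so
      the terms for these bonds vanish.\<close>
    then have "full_generator \<Theta> n y = generator \<theta> (n, y)"
      unfolding full_generator_eq_generator[OF hat] using L
      by (simp only:) (simp add: \<Theta>_def reflect_0 reflect_Suc_L reflect_id)
    with \<theta>[OF hat] show "full_generator coord_sq n y + full_generator \<Theta> n y = 2 * diffusivity" by simp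
  next
    have "full_generator coord_sq (1 - n) y = full_generator coord_sq n y" for n
      by (rule full_generator_reflect) (auto simp: coord_sq_def coord_reflect y)
    moreover have "full_generator \<Theta> (1 - n) y = full_generator \<Theta> n y" for n
      by (rule full_generator_reflect) (auto simp: \<Theta>_def reflect_reflect y)
    ultimately show "full_generator coord_sq (1 - n) y + full_generator \<Theta> (1 - n) y = 2 * diffusivity"
      if "full_generator coord_sq n y + full_generator \<Theta> n y = 2 * diffusivity" for n
      using that by simp
  next
    have "(\<lambda>n. \<Theta> (n + 2 * int L)) = \<Theta>"
      by (simp add: \<Theta>_def[abs_def] reflect_period)
    then have "full_generator \<Theta> (n + 2 * int L) y = full_generator \<Theta> n y" for n
      unfolding full_generator_shift[symmetric] by (simp only:)
    then have period: "full_generator coord_sq (n + 2 * int L) y + full_generator \<Theta> (n + 2 * int L) y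
        = full_generator coord_sq n y + full_generator \<Theta> n y" for n
      by (simp only: full_generator_coord_sq_period[OF y])
    show "full_generator coord_sq (n + 2 * int L) y + full_generator \<Theta> (n + 2 * int L) y = 2 * diffusivity"
      if "full_generator coord_sq n y + full_generator \<Theta> n y = 2 * diffusivity" for n
      using that unfolding period .
    show "full_generator coord_sq (n - 2 * int L) y + full_generator \<Theta> (n - 2 * int L) y = 2 * diffusivity"
      if "full_generator coord_sq n y + full_generator \<Theta> n y = 2 * diffusivity" for n
      using that period[of "n - 2 * int L"] by simp
  qed
  then show ?thesis
    by (intro that[of \<theta>]) (simp only: full_generator_add \<Theta>_def[abs_def])
qed

lemma coord_bound:
  obtains C where "C \<ge> 0" "\<And>n y. y \<in> T \<Longrightarrow> \<bar>coord n y - real_of_int n\<bar> \<le> C"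
proof -
  define C where "C = Max ((\<lambda>(n, y). \<bar>coord n y - real_of_int n\<bar>) ` ({1..2 * int L} \<times> T))"
  have le: "\<bar>coord n y - real_of_int n\<bar> \<le> C" if "1 \<le> n" "n \<le> 2 * int L" "y \<in> T" for n y
    unfolding C_def using that finite_torus by (intro Max_ge) (auto intro!: image_eqI[of _ _ "(n, y)"])
  show ?thesis
  proof (rule that[of C])
    show "C \<ge> 0" using le[of 1 0] zero_in_torus L by force
    fix n y assume y: "y \<in> T"
    show "\<bar>coord n y - real_of_int n\<bar> \<le> C"
    proof (rule all_periods[of "\<lambda>n. \<bar>coord n y - real_of_int n\<bar> \<le> C"])
      have period: "coord (n + 2 * int L) y - real_of_int (n + 2 * int L) = coord n y - real_of_int n" for n
        using coord_period[OF y] by simp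
      show "\<bar>coord (n + 2 * int L) y - real_of_int (n + 2 * int L)\<bar> \<le> C"
        if "\<bar>coord n y - real_of_int n\<bar> \<le> C" for n
        using that unfolding period .
      show "\<bar>coord (n - 2 * int L) y - real_of_int (n - 2 * int L)\<bar> \<le> C"
        if "\<bar>coord n y - real_of_int n\<bar> \<le> C" for n
        using that period[of "n - 2 * int L"] by simp
    qed (use le wrap_range y in blast)
  qed
qed

lemma translate_base: "translate i1 L ell k (2 * int L, 0) = (wrap (k $ i1), shift 0 k)"
proof -
  have "2 * int L + k $ i1 - 1 = k $ i1 - 1 + 2 * int L" by simp
  then show ?thesis by (simp only: translate_def split wrap_def mod_add_self2)
qed

text \<open>X(n) = n + O(1) because X(n) - n is periodic, so X^2 + \<theta> is n^2 + O(|n| + 1). The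
  profile is transported to the lattice by \<open>wrap\<close> and \<open>shift 0\<close>.\<close>

lemma corrected_square:
  obtains V C where "C \<ge> 0"
    and "\<And>k :: int ^ 'n. \<bar>V k - (real_of_int (k $ i1))\<^sup>2\<bar> \<le> C * (\<bar>real_of_int (k $ i1)\<bar> + 1)"
    and "\<And>k. lattice_generator V k = 2 * diffusivity"
proof -
  obtain \<theta> where \<theta>: "\<And>n y. y \<in> T \<Longrightarrow>
      full_generator (\<lambda>n y. coord_sq n y + \<theta> (reflect n, y)) n y = 2 * diffusivity"
    using profile_exists by blast
  obtain C where C: "C \<ge> 0" "\<And>n y. y \<in> T \<Longrightarrow> \<bar>coord n y - real_of_int n\<bar> \<le> C"
    using coord_bound by blast
  define C' where "C' = Max ((\<lambda>\<omega>. \<bar>\<theta> \<omega>\<bar>) ` hat)"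
  have C': "\<bar>\<theta> (reflect n, y)\<bar> \<le> C'" if "y \<in> T" for n y
    unfolding C'_def using that finite_hat wrap_range[of n]
    by (intro Max_ge) (auto intro!: image_eqI[of _ _ "(reflect n, y)"] simp: in_hat reflect_def)
  have C'0: "C' \<ge> 0" using C'[OF zero_in_torus, of 0] by linarith
  define P where "P n y = coord_sq n y + \<theta> (reflect n, y)" for n y
  define V where "V k = P (k $ i1) (shift 0 k)" for k
  show ?thesis
  proof (rule that[of "C\<^sup>2 + 2 * C + C'" V])
    show "C\<^sup>2 + 2 * C + C' \<ge> 0" using C C'0 by simp
  next
    fix k :: "int ^ 'n"
    define n where "n = real_of_int (k $ i1)"
    define e where "e = coord (k $ i1) (shift 0 k) - n"
    have e: "\<bar>e\<bar> \<le> C" unfolding e_def n_def by (rule C(2)[OF shift_in_torus])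
    have "V k - n\<^sup>2 = e\<^sup>2 + 2 * n * e + \<theta> (reflect (k $ i1), shift 0 k)"
      by (simp add: V_def P_def coord_sq_def e_def power2_eq_square algebra_simps)
    also have "\<bar>\<dots>\<bar> \<le> \<bar>e\<bar>\<^sup>2 + 2 * \<bar>n\<bar> * \<bar>e\<bar> + \<bar>\<theta> (reflect (k $ i1), shift 0 k)\<bar>"
      by (intro order_trans[OF abs_triangle_ineq] add_mono) (auto simp: abs_mult)
    also have "\<dots> \<le> C\<^sup>2 + 2 * \<bar>n\<bar> * C + C'"
      using e by (intro add_mono power_mono mult_left_mono C' shift_in_torus) auto
    also have "\<dots> \<le> (C\<^sup>2 + 2 * C + C') * (\<bar>n\<bar> + 1)"
      using C C'0 by (simp add: algebra_simps)
    finally show "\<bar>V k - (real_of_int (k $ i1))\<^sup>2\<bar> \<le> (C\<^sup>2 + 2 * C + C') * (\<bar>real_of_int (k $ i1)\<bar> + 1)"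
      by (simp add: n_def)
  next
    fix k :: "int ^ 'n"
    have side: "V (k + axis j 1) = P (k $ i1) (shift (shift 0 k) (axis j 1))"
      "V (k - axis j 1) = P (k $ i1) (shift (shift 0 k) (- axis j 1))" if "j \<noteq> i1" for j
      using that by (simp_all add: V_def shift_shift) (simp_all add: axis_def)
    have i1: "V (k + axis i1 1) = P (k $ i1 + 1) (shift 0 k)" "V (k - axis i1 1) = P (k $ i1 - 1) (shift 0 k)"
      using shift_axis_i1[of 0 k 1] shift_axis_i1[of 0 k "- 1"] by (simp_all add: V_def axis_minus)
    have "(\<Sum>i\<in>UNIV. V (k + axis i 1) + V (k - axis i 1) - 2 * V k)
        = (P (k $ i1 + 1) (shift 0 k) + P (k $ i1 - 1) (shift 0 k) - 2 * P (k $ i1) (shift 0 k))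
          + lap (P (k $ i1)) (shift 0 k)"
      unfolding laplacian_def
      by (subst sum.remove[of UNIV i1]) (auto simp: i1 side V_def[of k] intro!: sum.cong)
    moreover have "\<sigma> * lap (P (k $ i1)) (shift 0 k)
        + (\<sigma> + b (wrap (k $ i1), shift 0 k)) * (P (k $ i1 + 1) (shift 0 k) - P (k $ i1) (shift 0 k))
        + (\<sigma> - b (wrap (k $ i1), shift 0 k)) * (P (k $ i1 - 1) (shift 0 k) - P (k $ i1) (shift 0 k))
        = 2 * diffusivity"
      using \<theta>[OF shift_in_torus, of "k $ i1" 0 k]
      unfolding P_def[abs_def, symmetric] full_generator_def drift_at_def .
    ultimately show "lattice_generator V k = 2 * diffusivity"
      unfolding lattice_generator_def lattice_drift_def translate_base i1 by (simp only:) (simp add: algebra_simps)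
  qed
qed

end

section \<open>Lattice solutions and touching paraboloids\<close>

lemma lattice_point_nth: "lattice_point \<epsilon> k $ i = \<epsilon> * real_of_int (k $ i)"
  by (simp add: lattice_point_def)

lemma lattice_point_plus_axis: "lattice_point \<epsilon> k + \<epsilon> *\<^sub>R axis i 1 = lattice_point \<epsilon> (k + axis i 1)"
  and lattice_point_minus_axis: "lattice_point \<epsilon> k - \<epsilon> *\<^sub>R axis i 1 = lattice_point \<epsilon> (k - axis i 1)"
  by (auto simp: vec_eq_iff lattice_point_def axis_def algebra_simps)

lemma norm_vec_squared: "(norm (x :: real ^ 'n::finite))\<^sup>2 = (\<Sum>i\<in>UNIV. (x $ i)\<^sup>2)"
  by (simp add: norm_vec_def L2_set_def sum_nonneg)

lemma finite_lattice_ball: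
  assumes "\<epsilon> > 0"
  shows "finite {k :: int ^ 'n::finite. norm (lattice_point \<epsilon> k) \<le> \<rho>}"
proof -
  define m where "m = \<lceil>\<rho> / \<epsilon>\<rceil>"
  have "{k :: int ^ 'n. norm (lattice_point \<epsilon> k) \<le> \<rho>} \<subseteq> (\<lambda>f. \<chi> j. f j) ` (\<Pi>\<^sub>E j\<in>UNIV. {- m..m})"
  proof
    fix k :: "int ^ 'n" assume k: "k \<in> {k. norm (lattice_point \<epsilon> k) \<le> \<rho>}"
    have "\<bar>k $ j\<bar> \<le> m" for j
    proof -
      have "\<bar>\<epsilon> * real_of_int (k $ j)\<bar> \<le> \<rho>"
        using component_le_norm_cart[of "lattice_point \<epsilon> k" j] k by (simp add: lattice_point_nth)
      then have "\<bar>real_of_int (k $ j)\<bar> \<le> \<rho> / \<epsilon>"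
        using assms by (simp add: abs_mult field_simps)
      then show ?thesis unfolding m_def by linarith
    qed
    then show "k \<in> (\<lambda>f. \<chi> j. f j) ` (\<Pi>\<^sub>E j\<in>UNIV. {- m..m})"
      by (intro image_eqI[of _ _ "\<lambda>j. k $ j"]) (auto simp: abs_le_iff minus_le_iff)
  qed
  then show ?thesis by (rule finite_subset) (intro finite_imageI finite_PiE; simp)
qed

context reflected_walk
begin

lemma sum_2_\<sigma>: "(\<Sum>i\<in>(UNIV :: 'n set). 2 * \<sigma> * a) = a"
  by (simp add: \<sigma>)

text \<open>Dividing by 1 + \<epsilon>^2 makes the equation a fixed point problem: the jump weights
  are nonnegative and sum to 1, so the contraction factor is \<open>c\<close> = 1/(1 +
  \<epsilon>^2).\<close>

lemma lattice_solution_exists: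
  assumes \<epsilon>: "\<epsilon> > 0" and f: "\<And>x. \<bar>f x\<bar> \<le> C"
  shows "\<exists>u. bounded_lattice_solution i1 L ell b f \<epsilon> u"
proof -
  let ?I = "UNIV \<times> {1, - 1 :: int} :: ('n \<times> int) set"
  define c where "c = 1 / (1 + \<epsilon>\<^sup>2)"
  have pos: "1 + \<epsilon>\<^sup>2 > 0" by (simp add: add_pos_nonneg)
  then have c: "0 < c" "c < 1" and c_mult: "c * (1 + \<epsilon>\<^sup>2) = 1"
    using \<epsilon> by (auto simp: c_def divide_less_eq)
  have I_sum: "(\<Sum>i\<in>?I. F (fst i) (snd i)) = (\<Sum>i\<in>UNIV. F i 1 + F i (- 1))" for F :: "'n \<Rightarrow> int \<Rightarrow> real"
  proof -
    have "(\<Sum>i\<in>?I. F (fst i) (snd i)) = (\<Sum>(i, s)\<in>?I. F i s)" by (simp add: split_def)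
    also have "\<dots> = (\<Sum>i\<in>UNIV. \<Sum>s\<in>{1, - 1}. F i s)" by (rule sum.cartesian_product[symmetric])
    finally show ?thesis by simp
  qed
  define solves where "solves \<omega> g \<longleftrightarrow> (\<forall>k. \<bar>g k\<bar> \<le> C / (1 - c)) \<and> (\<forall>k. g k =
      c * ((\<Sum>i\<in>UNIV. \<sigma> * (g (k + axis i 1) + g (k - axis i 1)))
        + b (translate i1 L ell k \<omega>) * (g (k + axis i1 1) - g (k - axis i1 1)) + \<epsilon>\<^sup>2 * f (lattice_point \<epsilon> k)))"
    for \<omega> g
  have "\<exists>g. solves \<omega> g"
    if \<omega>: "\<omega> \<in> Omega i1 L ell" for \<omega>
  proof -
    define B where "B k = b (translate i1 L ell k \<omega>)" for k
    define W where "W i s k = c * (\<sigma> + of_bool (i = i1) * real_of_int s * B k)" for i s k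
    have B: "\<bar>B k\<bar> < \<sigma>" for k
      unfolding B_def by (intro drift translate_in_Omega)
    have W_nonneg: "W i s k \<ge> 0" if "s \<in> {1, - 1}" for i s k
      using that B[of k] c \<sigma>_pos by (auto simp: W_def abs_less_iff)
    have weights: "(\<Sum>i\<in>?I. \<bar>W (fst i) (snd i) k\<bar>) \<le> c" for k
    proof -
      have "(\<Sum>i\<in>?I. \<bar>W (fst i) (snd i) k\<bar>) = (\<Sum>i\<in>?I. W (fst i) (snd i) k)"
        using W_nonneg by (intro sum.cong refl) auto
      also have "\<dots> = (\<Sum>i\<in>(UNIV :: 'n set). 2 * \<sigma> * c)"
        unfolding I_sum[of "\<lambda>i s. W i s k"] by (intro sum.cong refl) (simp add: W_def algebra_simps)
      also have "\<dots> = c" by (rule sum_2_\<sigma>)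
      finally show ?thesis by simp
    qed
    have source: "\<bar>c * \<epsilon>\<^sup>2 * f (lattice_point \<epsilon> k)\<bar> \<le> C" for k
    proof -
      have "c * \<epsilon>\<^sup>2 \<le> 1" using c_mult c by (simp add: algebra_simps)
      then have "\<bar>c * \<epsilon>\<^sup>2\<bar> * \<bar>f (lattice_point \<epsilon> k)\<bar> \<le> 1 * C"
        using c f by (intro mult_mono) auto
      then show ?thesis by (simp only: abs_mult)
    qed
    have I: "finite ?I" by simp
    obtain g where g: "\<And>k. k \<in> UNIV \<Longrightarrow> \<bar>g k\<bar> \<le> C / (1 - c)"
      "\<And>k. k \<in> UNIV \<Longrightarrow> g k = (\<Sum>i\<in>?I. W (fst i) (snd i) k * g (k + axis (fst i) (snd i)))
          + c * \<epsilon>\<^sup>2 * f (lattice_point \<epsilon> k)"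
      using contraction_solvable[of ?I c UNIV "\<lambda>i. W (fst i) (snd i)" "\<lambda>i k. k + axis (fst i) (snd i)"
          "\<lambda>k. c * \<epsilon>\<^sup>2 * f (lattice_point \<epsilon> k)" C, OF I less_imp_le[OF c(1)] c(2) weights UNIV_I source]
      by blast
    have "(\<Sum>i\<in>?I. W (fst i) (snd i) k * g (k + axis (fst i) (snd i)))
        = c * ((\<Sum>i\<in>UNIV. \<sigma> * (g (k + axis i 1) + g (k - axis i 1))) + B k * (g (k + axis i1 1) - g (k - axis i1 1)))" for k
    proof -
      have "(\<Sum>i\<in>?I. W (fst i) (snd i) k * g (k + axis (fst i) (snd i)))
          = (\<Sum>i\<in>UNIV. c * (\<sigma> * (g (k + axis i 1) + g (k - axis i 1)))
              + of_bool (i = i1) * (c * B k * (g (k + axis i 1) - g (k - axis i 1))))"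
        unfolding I_sum[of "\<lambda>i s. W i s k * g (k + axis i s)"]
        by (intro sum.cong refl) (simp add: W_def axis_minus algebra_simps)
      also have "\<dots> = (\<Sum>i\<in>UNIV. c * (\<sigma> * (g (k + axis i 1) + g (k - axis i 1))))
          + c * B k * (g (k + axis i1 1) - g (k - axis i1 1))"
        by (simp add: sum.distrib of_bool_def if_distrib[of "\<lambda>t. t * _"] cong: if_cong)
      finally show ?thesis by (simp add: distrib_left sum_distrib_left)
    qed
    then have "g k = c * ((\<Sum>i\<in>UNIV. \<sigma> * (g (k + axis i 1) + g (k - axis i 1)))
        + b (translate i1 L ell k \<omega>) * (g (k + axis i1 1) - g (k - axis i1 1)) + \<epsilon>\<^sup>2 * f (lattice_point \<epsilon> k))" for k
      using g(2)[of k] by (simp only: B_def UNIV_I simp_thms distrib_left mult.assoc)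
    with g(1) show ?thesis unfolding solves_def by blast
  qed
  then have "\<forall>\<omega>\<in>Omega i1 L ell. \<exists>g. solves \<omega> g" by blast
  then obtain G where "\<forall>\<omega>\<in>Omega i1 L ell. solves \<omega> (G \<omega>)" by (rule bchoice[THEN exE])
  then have G: "\<bar>G \<omega> k\<bar> \<le> C / (1 - c)"
    "G \<omega> k = c * ((\<Sum>i\<in>UNIV. \<sigma> * (G \<omega> (k + axis i 1) + G \<omega> (k - axis i 1)))
        + b (translate i1 L ell k \<omega>) * (G \<omega> (k + axis i1 1) - G \<omega> (k - axis i1 1)) + \<epsilon>\<^sup>2 * f (lattice_point \<epsilon> k))"
    if "\<omega> \<in> Omega i1 L ell" for \<omega> k
    using that unfolding solves_def by blast+
  \<comment> \<open>A solution takes arguments in all of real space; rounding returns the exact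
    index at lattice points.\<close>
  define u where "u x \<omega> = G \<omega> (\<chi> i. round (x $ i / \<epsilon>))" for x \<omega>
  have u: "u (lattice_point \<epsilon> k) \<omega> = G \<omega> k" for k \<omega>
    using \<epsilon> by (simp add: u_def lattice_point_nth)
  have "G \<omega> k - (\<Sum>i\<in>UNIV. \<sigma> * (G \<omega> (k + axis i 1) + G \<omega> (k - axis i 1)))
      - b (translate i1 L ell k \<omega>) * (G \<omega> (k + axis i1 1) - G \<omega> (k - axis i1 1)) + \<epsilon>\<^sup>2 * G \<omega> k
      = \<epsilon>\<^sup>2 * f (lattice_point \<epsilon> k)" if "\<omega> \<in> Omega i1 L ell" for \<omega> k
  proof -
    have "(1 + \<epsilon>\<^sup>2) * G \<omega> k = (c * (1 + \<epsilon>\<^sup>2)) *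
        ((\<Sum>i\<in>UNIV. \<sigma> * (G \<omega> (k + axis i 1) + G \<omega> (k - axis i 1)))
        + b (translate i1 L ell k \<omega>) * (G \<omega> (k + axis i1 1) - G \<omega> (k - axis i1 1)) + \<epsilon>\<^sup>2 * f (lattice_point \<epsilon> k))"
      by (subst G(2)[OF that]) (simp only: mult_ac)
    then show ?thesis unfolding c_mult by (simp add: algebra_simps)
  qed
  then have "bounded_lattice_solution i1 L ell b f \<epsilon> u"
    unfolding bounded_lattice_solution_def Let_def lattice_point_plus_axis lattice_point_minus_axis u \<sigma>[symmetric]
    using G(1) by blast
  then show ?thesis by blast
qed

lemma bounded_lattice_solution_generator:
  assumes "bounded_lattice_solution i1 L ell b f \<epsilon> u"
  shows "lattice_generator (\<lambda>k. u (lattice_point \<epsilon> k) (2 * int L, 0)) k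
    = \<epsilon>\<^sup>2 * (u (lattice_point \<epsilon> k) (2 * int L, 0) - f (lattice_point \<epsilon> k))"
proof -
  define v where "v k = u (lattice_point \<epsilon> k) (2 * int L, 0)" for k
  have "(2 * int L, 0) \<in> Omega i1 L ell" using L zero_in_torus by (simp add: Omega_def)
  then have "v k - (\<Sum>i\<in>UNIV. \<sigma> * (v (k + axis i 1) + v (k - axis i 1)))
      - lattice_drift k * (v (k + axis i1 1) - v (k - axis i1 1)) + \<epsilon>\<^sup>2 * v k = \<epsilon>\<^sup>2 * f (lattice_point \<epsilon> k)"
    using assms
    unfolding bounded_lattice_solution_def Let_def lattice_point_plus_axis lattice_point_minus_axis
      \<sigma>[symmetric] v_def lattice_drift_def by blast
  moreover have "\<sigma> * (\<Sum>i\<in>UNIV. v (k + axis i 1) + v (k - axis i 1) - 2 * v k)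
      = (\<Sum>i\<in>UNIV. \<sigma> * (v (k + axis i 1) + v (k - axis i 1))) - (\<Sum>i\<in>(UNIV :: 'n set). 2 * \<sigma> * v k)"
    unfolding sum_distrib_left sum_subtractf[symmetric] by (intro sum.cong refl) (simp add: algebra_simps)
  ultimately show ?thesis
    unfolding lattice_generator_def v_def[symmetric] sum_2_\<sigma> by (simp only:) (simp add: algebra_simps)
qed

end

context two_walks
begin

text \<open>
  Perturbed test function: \<open>V\<close> corrects \<open>k\<^sub>1\<^sup>2\<close> so that the generator maps the paraboloid to a constant, and the
  paraboloid touches \<open>u\<^sub>\<epsilon>\<close> from below at a point close to \<open>0\<close>.
\<close>

lemma touching_paraboloid_le:
  fixes u f :: "real ^ 'n \<Rightarrow> real"
  assumes solution: "\<And>\<epsilon>. \<epsilon> > 0 \<Longrightarrow> bounded_lattice_solution i1 L ell b f \<epsilon> (u\<^sub>\<epsilon> \<epsilon>)"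
    and conv: "\<And>\<eta>. \<eta> > 0 \<Longrightarrow> \<forall>\<^sub>F \<epsilon> in at_right 0. \<forall>k.
        \<bar>u\<^sub>\<epsilon> \<epsilon> (lattice_point \<epsilon> k) (2 * int L, 0) - u (lattice_point \<epsilon> k)\<bar> \<le> \<eta>"
    and r: "r > 0" and \<kappa>: "\<kappa> > 0"
    and below: "\<And>x. norm x \<le> r \<Longrightarrow> u 0 + a / 2 * (norm x)\<^sup>2 + \<kappa> * (norm x)\<^sup>2 \<le> u x"
    and cont: "isCont (\<lambda>x. u x - f x) 0"
  shows "a * (diffusivity + \<sigma> * real (CARD('n) - 1)) \<le> u 0 - f 0"
proof (rule field_le_epsilon)
  fix \<delta> :: real assume \<delta>: "\<delta> > 0"
  obtain V C where C: "C \<ge> 0"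
    and V: "\<And>k :: int ^ 'n. \<bar>V k - (real_of_int (k $ i1))\<^sup>2\<bar> \<le> C * (\<bar>real_of_int (k $ i1)\<bar> + 1)"
    and gen_V: "\<And>k. lattice_generator V k = 2 * diffusivity"
    by (rule corrected_square) (rule that; assumption)
  obtain \<rho> where \<rho>: "\<rho> > 0" "\<rho> \<le> r" "\<And>x. norm x \<le> \<rho> \<Longrightarrow> u x - f x \<le> u 0 - f 0 + \<delta> / 2"
  proof -
    obtain s where s: "s > 0" "\<And>x. norm x < s \<Longrightarrow> \<bar>(u x - f x) - (u 0 - f 0)\<bar> < \<delta> / 2"
      using cont[unfolded continuous_at_eps_delta, rule_format, of "\<delta> / 2"] \<delta>
      by (auto simp: dist_norm)
    have "u x - f x \<le> u 0 - f 0 + \<delta> / 2" if "norm x \<le> min r (s / 2)" for x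
    proof -
      have "norm x < s" using that s(1) by linarith
      from s(2)[OF this] show ?thesis by linarith
    qed
    then show ?thesis using r s(1) by (intro that[of "min r (s / 2)"]) auto
  qed
  \<comment> \<open>Comparing \<open>z\<close> at the minimizer and at 0 costs 4 \<eta>: at each
    point one \<eta> for \<open>W\<close> and one for u_eps. Then \<open>\<kappa> * N k\<close>
    \<le> 4 \<eta> \<le> \<kappa> \<rho>^2 / 8 puts the minimizer in the ball of radius \<rho>/2.
    The bound \<delta>/2 is what continuity of \<open>u - f\<close> leaves over.\<close>
  define \<eta> where "\<eta> = min (\<delta> / 2) (\<kappa> * \<rho>\<^sup>2 / 32)"
  have \<eta>: "\<eta> > 0" "\<eta> \<le> \<delta> / 2" "32 * \<eta> \<le> \<kappa> * \<rho>\<^sup>2" using \<delta> \<kappa> \<rho> by (auto simp: \<eta>_def)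
  have "((\<lambda>\<epsilon>. \<bar>a\<bar> / 2 * C * (\<epsilon> * \<rho> + \<epsilon>\<^sup>2)) \<longlongrightarrow> \<bar>a\<bar> / 2 * C * (0 * \<rho> + 0\<^sup>2)) (at_right 0)"
    by (intro tendsto_intros)
  then have small: "\<forall>\<^sub>F \<epsilon> in at_right 0. \<bar>a\<bar> / 2 * C * (\<epsilon> * \<rho> + \<epsilon>\<^sup>2) < \<eta>"
    using \<eta> by (intro order_tendstoD(2)) auto
  have "\<forall>\<^sub>F \<epsilon> in at_right 0. \<epsilon> < \<rho> / 2"
    using \<rho> by (intro order_tendstoD(2)[OF tendsto_ident_at]) auto
  from eventually_conj[OF eventually_conj[OF conv[OF \<eta>(1)] small] eventually_conj[OF this eventually_at_right_less]]
  obtain \<epsilon> where \<epsilon>: "\<epsilon> > 0" "\<epsilon> < \<rho> / 2" "\<bar>a\<bar> / 2 * C * (\<epsilon> * \<rho> + \<epsilon>\<^sup>2) < \<eta>"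
    and close: "\<And>k. \<bar>u\<^sub>\<epsilon> \<epsilon> (lattice_point \<epsilon> k) (2 * int L, 0) - u (lattice_point \<epsilon> k)\<bar> \<le> \<eta>"
    using eventually_happens[of _ "at_right (0 :: real)"] by (auto simp: trivial_limit_at_right_real)
  define v where "v k = u\<^sub>\<epsilon> \<epsilon> (lattice_point \<epsilon> k) (2 * int L, 0)" for k
  define N where "N k = (norm (lattice_point \<epsilon> k))\<^sup>2" for k :: "int ^ 'n"
  define q where "q k = (\<Sum>j\<in>UNIV - {i1}. (real_of_int (k $ j))\<^sup>2)" for k :: "int ^ 'n"
  define W where "W k = a / 2 * \<epsilon>\<^sup>2 * (V k + q k)" for k
  define z where "z k = v k - W k" for k
  have N: "N k = \<epsilon>\<^sup>2 * ((real_of_int (k $ i1))\<^sup>2 + q k)" for k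
  proof -
    have "N k = \<epsilon>\<^sup>2 * (\<Sum>j\<in>UNIV. (real_of_int (k $ j))\<^sup>2)"
      by (simp add: N_def norm_vec_squared lattice_point_nth power_mult_distrib sum_distrib_left)
    then show ?thesis unfolding q_def by (subst (asm) sum.remove[of UNIV i1]) auto
  qed
  define K where "K = {k :: int ^ 'n. norm (lattice_point \<epsilon> k) \<le> \<rho>}"
  have K_finite: "finite K" unfolding K_def using \<epsilon> by (intro finite_lattice_ball)
  have lattice_0: "lattice_point \<epsilon> 0 = (0 :: real ^ 'n)"
    by (simp add: vec_eq_iff lattice_point_nth)
  then have K_0: "0 \<in> K" using \<rho> by (simp add: K_def)
  have W: "\<bar>W k - a / 2 * N k\<bar> \<le> \<eta>" if "k \<in> K" for k
  proof -
    have "\<epsilon> * \<bar>real_of_int (k $ i1)\<bar> \<le> \<rho>"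
      using component_le_norm_cart[of "lattice_point \<epsilon> k" i1] that \<epsilon>
      by (simp add: lattice_point_nth K_def abs_mult)
    then have k1: "\<epsilon>\<^sup>2 * (\<bar>real_of_int (k $ i1)\<bar> + 1) \<le> \<epsilon> * \<rho> + \<epsilon>\<^sup>2"
      using \<epsilon> by (simp add: power2_eq_square distrib_left mult.assoc)
    have "W k - a / 2 * N k = a / 2 * \<epsilon>\<^sup>2 * (V k - (real_of_int (k $ i1))\<^sup>2)"
      by (simp add: W_def N algebra_simps)
    then have "\<bar>W k - a / 2 * N k\<bar> = \<bar>a\<bar> / 2 * \<epsilon>\<^sup>2 * \<bar>V k - (real_of_int (k $ i1))\<^sup>2\<bar>"
      by (simp only: abs_mult) simp
    also have "\<dots> \<le> \<bar>a\<bar> / 2 * \<epsilon>\<^sup>2 * (C * (\<bar>real_of_int (k $ i1)\<bar> + 1))"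
      by (intro mult_left_mono V) simp
    also have "\<dots> = \<bar>a\<bar> / 2 * C * (\<epsilon>\<^sup>2 * (\<bar>real_of_int (k $ i1)\<bar> + 1))" by simp
    also have "\<dots> \<le> \<bar>a\<bar> / 2 * C * (\<epsilon> * \<rho> + \<epsilon>\<^sup>2)"
      using k1 C by (intro mult_left_mono) auto
    finally show ?thesis using \<epsilon> by linarith
  qed
  obtain k where k: "k \<in> K" "\<And>l. l \<in> K \<Longrightarrow> z k \<le> z l"
  proof -
    have "z ` K \<noteq> {}" using K_0 by auto
    then obtain k where "k \<in> K" "z k = Min (z ` K)"
      using Min_in[of "z ` K"] K_finite by (metis finite_imageI imageE)
    then show ?thesis using K_finite by (intro that[of k]) auto
  qed
  have lower: "u 0 + \<kappa> * N k \<le> z k + 2 * \<eta>"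
  proof -
    have "norm (lattice_point \<epsilon> k) \<le> r" using k(1) \<rho> by (simp add: K_def)
    from below[OF this] have "u 0 + a / 2 * N k + \<kappa> * N k \<le> u (lattice_point \<epsilon> k)" by (simp add: N_def)
    then show ?thesis using W[OF k(1)] close[of k] unfolding z_def v_def by linarith
  qed
  have upper: "z 0 \<le> u 0 + 2 * \<eta>"
    using W[OF K_0] close[of 0] by (simp add: z_def v_def N_def lattice_0)
  have "\<kappa> * N k \<le> 4 * \<eta>" using lower upper k(2)[OF K_0] by linarith
  then have "\<kappa> * (8 * N k) \<le> \<kappa> * \<rho>\<^sup>2" using \<eta> by linarith
  then have "8 * N k \<le> \<rho>\<^sup>2" using \<kappa> by simp
  moreover have "N k \<ge> 0" by (simp add: N_def)
  ultimately have "N k \<le> \<rho>\<^sup>2 / 4" by linarith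
  then have "(norm (lattice_point \<epsilon> k))\<^sup>2 \<le> (\<rho> / 2)\<^sup>2" by (simp add: N_def power_divide)
  then have interior: "norm (lattice_point \<epsilon> k) \<le> \<rho> / 2"
    by (rule power2_le_imp_le) (use \<rho> in simp)
  \<comment> \<open>As \<epsilon> < \<rho>/2, all neighbours of the minimizer lie in
    \<open>K\<close>, so the minimum over \<open>K\<close> is one among neighbours.\<close>
  have axis: "norm (\<epsilon> *\<^sub>R axis i 1 :: real ^ 'n) = \<epsilon>" for i using \<epsilon> by simp
  have "k + axis i 1 \<in> K" for i
    using norm_triangle_ineq[of "lattice_point \<epsilon> k" "\<epsilon> *\<^sub>R axis i 1"] interior \<epsilon> axis[of i]
    by (simp add: K_def flip: lattice_point_plus_axis)
  moreover have "k - axis i 1 \<in> K" for i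
    using norm_triangle_ineq4[of "lattice_point \<epsilon> k" "\<epsilon> *\<^sub>R axis i 1"] interior \<epsilon> axis[of i]
    by (simp add: K_def flip: lattice_point_minus_axis)
  ultimately have "0 \<le> lattice_generator z k"
    by (intro lattice_generator_nonneg_at_min k(2))
  also have "lattice_generator z k = lattice_generator v k - lattice_generator W k"
    unfolding z_def[abs_def] by (rule lattice_generator_diff)
  also have "lattice_generator W k = a * \<epsilon>\<^sup>2 * (diffusivity + \<sigma> * real (CARD('n) - 1))"
    unfolding W_def[abs_def] lattice_generator_scale lattice_generator_add gen_V
    unfolding q_def[abs_def] lattice_generator_squares by (simp add: algebra_simps)
  also have "lattice_generator v k = \<epsilon>\<^sup>2 * (v k - f (lattice_point \<epsilon> k))"
    unfolding v_def[abs_def] by (rule bounded_lattice_solution_generator[OF solution[OF \<epsilon>(1)]])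
  finally have "\<epsilon>\<^sup>2 * (a * (diffusivity + \<sigma> * real (CARD('n) - 1))) \<le> \<epsilon>\<^sup>2 * (v k - f (lattice_point \<epsilon> k))"
    by (simp add: algebra_simps)
  then have "a * (diffusivity + \<sigma> * real (CARD('n) - 1)) \<le> v k - f (lattice_point \<epsilon> k)"
    using \<epsilon> by simp
  also have "\<dots> \<le> u 0 - f 0 + \<delta>"
    using close[of k] \<eta>(2) \<rho>(3)[of "lattice_point \<epsilon> k"] k(1) unfolding v_def K_def by fastforce
  finally show "a * (diffusivity + \<sigma> * real (CARD('n) - 1)) \<le> u 0 - f 0 + \<delta>" .
qed

end

section \<open>Identification of the effective diffusion constant\<close>

context two_walks
begin

text \<open>Here \<open>f\<close> is defined so that \<open>u\<close> solves the homogenized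
  equation with the given \<open>q\<close>; at 0 the difference \<open>u - f\<close> is then the
  right-hand side below.\<close>

lemma homogenized_bump:
  assumes q: "effective_diffusion_constant i1 L ell b q" and u: "u \<in> bumps"
    and below: "r > 0" "\<kappa> > 0" "\<And>x. norm x \<le> r \<Longrightarrow> u 0 + a / 2 * (norm x)\<^sup>2 + \<kappa> * (norm x)\<^sup>2 \<le> u x"
  shows "a * (diffusivity + \<sigma> * real (CARD('n) - 1))
    \<le> q * partial i1 (partial i1 u) 0 + \<sigma> * (\<Sum>j\<in>UNIV - {i1}. partial j (partial j u) 0)"
proof -
  \<comment> \<open>The sum runs over all directions with coefficient 0 at \<open>i1\<close> so that
    its index set is nonempty, as \<open>bumps_sum\<close> requires, also when d = 1.\<close>
  define f where "f x = - q * partial i1 (partial i1 u) x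
      + (u x + (\<Sum>j\<in>UNIV. (if j = i1 then 0 else - \<sigma>) * partial j (partial j u) x))" for x
  have f_bumps: "f \<in> bumps"
    unfolding f_def[abs_def]
    by (intro bumps.add bumps_scale bumps_sum bumps_partial u) auto
  have f_eq: "f x = - q * partial i1 (partial i1 u) x
      - (\<Sum>j\<in>UNIV - {i1}. \<sigma> * partial j (partial j u) x) + u x" for x
    unfolding f_def by (subst sum.remove[of UNIV i1]) (simp_all add: sum_negf[symmetric])
  obtain Cf where Cf: "\<And>x. \<bar>f x\<bar> \<le> Cf"
    using bumps_bounded[OF f_bumps] by (auto simp: bounded_iff)
  obtain Cu where Cu: "\<And>x. \<bar>u x\<bar> \<le> Cu"
    using bumps_bounded[OF u] by (auto simp: bounded_iff)
  define u\<^sub>\<epsilon> where "u\<^sub>\<epsilon> \<epsilon> = (SOME v. bounded_lattice_solution i1 L ell b f \<epsilon> v)" for \<epsilon>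
  have u\<^sub>\<epsilon>: "bounded_lattice_solution i1 L ell b f \<epsilon> (u\<^sub>\<epsilon> \<epsilon>)" if "\<epsilon> > 0" for \<epsilon>
    unfolding u\<^sub>\<epsilon>_def using lattice_solution_exists[OF that Cf] by (rule someI_ex)
  let ?F = "\<lambda>\<epsilon> (x, \<omega>). \<bar>u\<^sub>\<epsilon> \<epsilon> (lattice_point \<epsilon> (\<chi> i. \<lfloor>x $ i / \<epsilon>\<rfloor>)) \<omega> - u x\<bar>"
  let ?S = "UNIV \<times> Omega i1 L ell"
  have homogenized: "bounded_homogenized_solution i1 q f u"
    unfolding bounded_homogenized_solution_def \<sigma>[symmetric]
    using bumps_bounded[OF u] bumps_cont_diff[OF u] by (simp add: f_eq)
  have smooth: "smooth f"
    unfolding smooth_def using bumps_cont_diff[OF f_bumps] by blast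
  have conv: "((\<lambda>\<epsilon>. SUP p\<in>?S. ?F \<epsilon> p) \<longlongrightarrow> 0) (at_right 0)"
    using q[unfolded effective_diffusion_constant_def] smooth bumps_compactly_supported[OF f_bumps]
      homogenized u\<^sub>\<epsilon> by blast
  have base: "(2 * int L, 0) \<in> Omega i1 L ell" using L zero_in_torus by (simp add: Omega_def)
  have close: "\<bar>u\<^sub>\<epsilon> \<epsilon> (lattice_point \<epsilon> k) (2 * int L, 0) - u (lattice_point \<epsilon> k)\<bar> \<le> (SUP p\<in>?S. ?F \<epsilon> p)"
    if \<epsilon>: "\<epsilon> > 0" for \<epsilon> k
  proof -
    obtain C where C: "\<And>k \<omega>. \<omega> \<in> Omega i1 L ell \<Longrightarrow> \<bar>u\<^sub>\<epsilon> \<epsilon> (lattice_point \<epsilon> k) \<omega>\<bar> \<le> C"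
      using u\<^sub>\<epsilon>[OF \<epsilon>] unfolding bounded_lattice_solution_def by blast
    have "bdd_above (?F \<epsilon> ` ?S)"
    proof (rule bdd_aboveI[of _ "C + Cu"])
      fix t assume "t \<in> ?F \<epsilon> ` ?S"
      then obtain x \<omega> where "\<omega> \<in> Omega i1 L ell"
        and t: "t = \<bar>u\<^sub>\<epsilon> \<epsilon> (lattice_point \<epsilon> (\<chi> i. \<lfloor>x $ i / \<epsilon>\<rfloor>)) \<omega> - u x\<bar>" by auto
      with C[of \<omega> "\<chi> i. \<lfloor>x $ i / \<epsilon>\<rfloor>"] Cu[of x] show "t \<le> C + Cu" by linarith
    qed
    then have "?F \<epsilon> (lattice_point \<epsilon> k, (2 * int L, 0)) \<le> (SUP p\<in>?S. ?F \<epsilon> p)"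
      using base by (intro cSUP_upper) auto
    \<comment> \<open>Evaluating the supremum at a lattice point makes the floor exact, so it bounds
      the error there.\<close>
    moreover have "(\<chi> i. \<lfloor>lattice_point \<epsilon> k $ i / \<epsilon>\<rfloor>) = k"
      using \<epsilon> by (simp add: lattice_point_nth vec_eq_iff)
    ultimately show ?thesis by simp
  qed
  have cont: "isCont (\<lambda>x. u x - f x) 0"
    using bumps_continuous[OF u, of UNIV] bumps_continuous[OF f_bumps, of UNIV]
    by (intro continuous_diff) (auto simp: continuous_on_eq_continuous_at)
  have "a * (diffusivity + \<sigma> * real (CARD('n) - 1)) \<le> u 0 - f 0"
  proof (rule touching_paraboloid_le[OF u\<^sub>\<epsilon> _ below cont])
    fix \<eta> :: real assume "\<eta> > 0"
    with conv have "\<forall>\<^sub>F \<epsilon> in at_right 0. (SUP p\<in>?S. ?F \<epsilon> p) < \<eta>" by (rule order_tendstoD(2))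
    with eventually_at_right_less
    show "\<forall>\<^sub>F \<epsilon> in at_right 0. \<forall>k.
        \<bar>u\<^sub>\<epsilon> \<epsilon> (lattice_point \<epsilon> k) (2 * int L, 0) - u (lattice_point \<epsilon> k)\<bar> \<le> \<eta>"
    proof eventually_elim
      case (elim \<epsilon>)
      then show ?case using close[of \<epsilon>] by (meson less_imp_le order_trans)
    qed
  qed
  then show ?thesis by (simp add: f_eq sum_distrib_left)
qed

text \<open>All second derivatives of the bump at 0 are equal and nonzero, so each comparison is an
  inequality between sums of diffusion coefficients times that number; the signs \<open>c\<close> =
  1 and \<open>c\<close> = -1 give the two directions.\<close>

lemma effective_diffusion_constant_eq_diffusivity:
  assumes q: "effective_diffusion_constant i1 L ell b q"
  shows "q = diffusivity"
proof -
  define B where "B = std_bump (0 :: real ^ 'n)"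
  define M where "M = diffusivity + \<sigma> * real (CARD('n) - 1)"
  have B: "B > 0" by (simp add: B_def std_bump_0)
  have le: "c * (- 4 * B) * M \<le> c * (- 4 * B) * (q + \<sigma> * real (CARD('n) - 1))" if c: "\<bar>c\<bar> = 1" for c
  proof -
    define u where "u x = c * std_bump x" for x :: "real ^ 'n"
    define a0 where "a0 = c * (- 4 * B)"
    have u: "u \<in> bumps" unfolding u_def[abs_def] by (intro bumps_scale std_bump_in_bumps)
    have deriv: "partial j (partial j u) 0 = a0" for j
    proof -
      have "partial j u = (\<lambda>x. c * partial j std_bump x)"
        unfolding u_def[abs_def] by (intro partial_scale bumps_differentiable std_bump_in_bumps)
      then have "partial j (partial j u) = (\<lambda>x. c * partial j (partial j std_bump) x)"
        by (simp add: partial_scale bumps_differentiable bumps_partial std_bump_in_bumps)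
      then show ?thesis by (simp add: partial_partial_std_bump_0 a0_def B_def)
    qed
    \<comment> \<open>Touching needs a strict gap \<kappa> > 0, so the curvature \<open>a\<close>
      stays below \<open>a0\<close> and tends to it at the end.\<close>
    have "a * M \<le> a0 * (q + \<sigma> * real (CARD('n) - 1))" if a: "a < a0" for a
    proof -
      \<comment> \<open>1/2 is the range of \<open>std_bump_taylor\<close>. The other bound makes
        its error at most (a0 - a)/4 times N; as (a0 - a)/2 is available, (a0 - a)/4 remains for
        \<kappa>.\<close>
      define s where "s = min (1 / 2) ((a0 - a) / (80 * B))"
      have s: "s > 0" "s \<le> 1 / 2" "20 * B * s \<le> (a0 - a) / 4"
        using a B by (auto simp: s_def field_simps min_def)
      have "a * M \<le> q * partial i1 (partial i1 u) 0 + \<sigma> * (\<Sum>j\<in>UNIV - {i1}. partial j (partial j u) 0)"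
        unfolding M_def
      proof (rule homogenized_bump[OF q u, of "sqrt s" "(a0 - a) / 4"])
        fix x :: "real ^ 'n" assume "norm x \<le> sqrt s"
        then have "(norm x)\<^sup>2 \<le> (sqrt s)\<^sup>2" by (intro power_mono) auto
        define N where "N = (norm x)\<^sup>2"
        have N: "N \<ge> 0" "N \<le> s" using \<open>(norm x)\<^sup>2 \<le> (sqrt s)\<^sup>2\<close> s by (auto simp: N_def)
        have "\<bar>std_bump x - B * (1 - 2 * N)\<bar> \<le> 20 * B * N\<^sup>2"
          using std_bump_taylor[of x] N s by (simp add: N_def B_def flip: power_mult)
        then have "\<bar>c\<bar> * \<bar>std_bump x - B * (1 - 2 * N)\<bar> \<le> 20 * B * N\<^sup>2" using c by simp
        then have "\<bar>u x - c * B * (1 - 2 * N)\<bar> \<le> 20 * B * N\<^sup>2"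
          unfolding abs_mult[symmetric] by (simp add: u_def right_diff_distrib mult.assoc)
        moreover have "20 * B * N\<^sup>2 \<le> (a0 - a) / 4 * N"
        proof -
          have "20 * B * N \<le> 20 * B * s" using N B by simp
          then have "20 * B * N \<le> (a0 - a) / 4" using s by linarith
          then have "20 * B * N * N \<le> (a0 - a) / 4 * N" using N by (intro mult_right_mono)
          then show ?thesis by (simp add: power2_eq_square mult.assoc)
        qed
        moreover have "u 0 = c * B" by (simp add: u_def B_def)
        moreover have "c * B * (1 - 2 * N) = c * B + a0 / 2 * N" by (simp add: a0_def algebra_simps)
        moreover have "a / 2 * N + (a0 - a) / 4 * N = a0 / 2 * N - (a0 - a) / 4 * N"
          by (simp add: field_simps)
        ultimately show "u 0 + a / 2 * (norm x)\<^sup>2 + (a0 - a) / 4 * (norm x)\<^sup>2 \<le> u x"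
          unfolding N_def[symmetric] by linarith
      qed (use s a in auto)
      then show ?thesis by (simp add: deriv algebra_simps)
    qed
    then have "\<forall>\<^sub>F a in at_left a0. a * M \<le> a0 * (q + \<sigma> * real (CARD('n) - 1))"
      by (auto simp: eventually_at_filter)
    moreover have "((\<lambda>a. a * M) \<longlongrightarrow> a0 * M) (at_left a0)"
      by (intro tendsto_intros)
    ultimately have "a0 * M \<le> a0 * (q + \<sigma> * real (CARD('n) - 1))"
      by (intro tendsto_upperbound) auto
    then show ?thesis by (simp add: a0_def)
  qed
  have "q + \<sigma> * real (CARD('n) - 1) \<le> M" using le[of 1] B by simp
  moreover have "M \<le> q + \<sigma> * real (CARD('n) - 1)" using le[of "- 1"] B by simp
  ultimately show ?thesis by (simp add: M_def)
qed

lemma diffusivity_eq: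
  "diffusivity = 8 * real CARD('n) * avg T (\<lambda>y. psi b \<phi> y *
     inv_neg_laplacian_plus_4 i1 ell (psi (\<lambda>\<omega>. - b \<omega>) \<phi>\<^sub>R) y)"
proof -
  have "2 / \<sigma> = 4 * real CARD('n)" by (simp add: \<sigma>)
  then show ?thesis
    by (simp add: diffusivity_def coord1_def avg_def sum_distrib_left mult_ac)
qed

end

theorem mainTheorem3:
  fixes i1 :: "'n::finite" and L :: nat and ell :: "'n \<Rightarrow> nat"
    and b \<phi> \<phi>\<^sub>R :: "int \<times> (int ^ 'n) \<Rightarrow> real" and q :: real
  assumes "L \<ge> 1"
    and "\<And>j. j \<noteq> i1 \<Longrightarrow> ell j \<ge> 1"
    and "(SUP \<omega>\<in>Omega i1 L ell. \<bar>b \<omega>\<bar>) < 1 / (2 * real CARD('n))"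
    and "\<And>n y. 1 \<le> n \<Longrightarrow> n \<le> 2 * int L \<Longrightarrow> y \<in> torus i1 ell \<Longrightarrow>
           b (2 * int L + 1 - n, y) = - b (n, y)"
    and "invariant_density i1 L ell b \<phi>"
    and "invariant_density i1 L ell (\<lambda>\<omega>. - b \<omega>) \<phi>\<^sub>R"
    and "effective_diffusion_constant i1 L ell b q"
  shows "q = 8 * real CARD('n) *
           avg (torus i1 ell) (\<lambda>y. psi b \<phi> y *
             inv_neg_laplacian_plus_4 i1 ell (psi (\<lambda>\<omega>. - b \<omega>) \<phi>\<^sub>R) y)"
proof -
  interpret torus_setup i1 ell by unfold_locales (rule assms(2))
  define \<sigma> where "\<sigma> = 1 / (2 * real CARD('n))"
  have drift: "\<bar>b \<omega>\<bar> < \<sigma>" if "\<omega> \<in> Omega i1 L ell" for \<omega>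
  proof -
    have "finite (Omega i1 L ell)" by (simp add: Omega_def finite_torus)
    then have "\<bar>b \<omega>\<bar> \<le> (SUP \<omega>\<in>Omega i1 L ell. \<bar>b \<omega>\<bar>)"
      using that by (intro cSUP_upper) auto
    with assms(3) show ?thesis by (simp add: \<sigma>_def)
  qed
  interpret two_walks i1 ell L b \<sigma> \<phi> \<phi>\<^sub>R
    by unfold_locales (use assms drift in \<open>auto simp: \<sigma>_def\<close>)
  show ?thesis
    using effective_diffusion_constant_eq_diffusivity[OF assms(7)] diffusivity_eq by simp
qed

end
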